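(* Let $\alpha$ be a twisted partial action of a group $G$ on a unital ring $R$ such that every ideal $D_g$ is generated by a central idempotent $1_g$. Suppose that $R$ is maximal commutative in the partial crossed product $R*_{\alpha}^{w}G$. Then $R*_{\alpha}^{w}G$ is simple if and only if $R$ is $\alpha$-simple.
   Context: $G$ is a group with identity $e$ and $R$ is an associative ring with identity $1_R$. A twisted partial action of $G$ on $R$ is a triple $\alpha=(\{D_g\}_{g\in G},\{\alpha_g\}_{g\in G},\{w_{g,h}\}_{(g,h)\in G\times G})$ where each $D_g$ is a two-sided ideal of $R$, $\alpha_g:D_{g^{-1}}\to D_g$ is a ring isomorphism, and $w_{g,h}$ is an invertible element of the multiplier ring of $D_gD_{gh}$, such that for all $g,h,t\in G$: (i) $D_g^2=D_g$ and $D_gD_h=D_hD_g$; (ii) $D_e=R$ and $\alpha_e=\mathrm{id}_R$; (iii) $\alpha_g(D_{g^{-1}}D_h)=D_gD_{gh}$; (iv) $\alpha_g\circ\alpha_h(a)=w_{g,h}\alpha_{gh}(a)w_{g,h}^{-1}$ for all $a\in D_{h^{-1}}D_{h^{-1}g^{-1}}$; (v) $w_{g,e}=w_{e,g}=1$ (the identity multiplier); (vi) $\alpha_g(aw_{h,t})w_{g,ht}=\alpha_g(a)w_{g,h}w_{gh,t}$ for all $a\in D_{g^{-1}}D_hD_{ht}$. Standing assumption: each $D_g$ is generated by an idempotent $1_g$ that is central in $R$. Hence $D_gD_{gh}$ is a unital ring with identity $1_g1_{gh}$, $w_{g,h}$ is identified with an invertible element of the ring $D_gD_{gh}$, and $w_{g,e}=w_{e,g}=1_g$.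 The partial crossed product $R*_{\alpha}^{w}G$ is $\bigoplus_{g\in G}D_g\delta_g$ (the $\delta_g$ are symbols) with the usual addition and multiplication $(a_g\delta_g)(b_h\delta_h)=\alpha_g(\alpha_g^{-1}(a_g)b_h)w_{g,h}\delta_{gh}$; it is an associative ring with identity $1_R\delta_e$, and $R$ is identified with $R\delta_e$. For a subset $Y$ of a ring $S$, $C_S(Y)=\{s\in S: sy=ys\ \forall y\in Y\}$. $R$ is maximal commutative in $R*_{\alpha}^{w}G$ if $R=C_{R*_{\alpha}^{w}G}(R)$. An ideal $I$ of $R$ is $\alpha$-invariant if $\alpha_g(I\cap D_{g^{-1}})\subseteq I\cap D_g$ for all $g\in G$. $R$ is $\alpha$-simple if its only $\alpha$-invariant (two-sided) ideals are the trivial ones, $\{0\}$ and $R$. *)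

theory Defs
  imports "HOL-Algebra.Ideal_Product" "HOL-Algebra.QuotRing"
begin

text \<open>An ideal \<open>I\<close> of \<open>R\<close> that has its own identity element \<open>u\<close>, regarded as a unital ring.\<close>

definition ideal_ring :: "('r, 'm) ring_scheme \<Rightarrow> 'r set \<Rightarrow> 'r \<Rightarrow> ('r, 'm) ring_scheme" where
  "ideal_ring R I u = R\<lparr>carrier := I, one := u\<rparr>"

text \<open>
  Twisted partial actions for which every \<open>D g\<close> is generated by a central idempotent, here
  denoted \<open>u g\<close>. The product ideal of \<open>D g\<close> and \<open>D (g h)\<close> is then a unital ring with identity
  \<open>u g \<otimes> u (g h)\<close>, so its multiplier ring is the ring itself: the twist \<open>w g h\<close> is an
  invertible element of that ring, and multipliers act by multiplication in \<open>R\<close>.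
  Only the values of \<open>\<alpha> g\<close> on \<open>D (inv g)\<close> are relevant.
\<close>

locale unital_twisted_partial_action = G: group G + R: ring R
  for G :: "('g, 'n) monoid_scheme" (structure)
    and R :: "('r, 'm) ring_scheme" (structure) +
  fixes D :: "'g \<Rightarrow> 'r set"
    and \<alpha> :: "'g \<Rightarrow> 'r \<Rightarrow> 'r"
    and w :: "'g \<Rightarrow> 'g \<Rightarrow> 'r"
    and u :: "'g \<Rightarrow> 'r"
  assumes D_ideal: "g \<in> carrier G \<Longrightarrow> ideal (D g) R"
    and u_closed: "g \<in> carrier G \<Longrightarrow> u g \<in> carrier R"
    and u_idem: "g \<in> carrier G \<Longrightarrow> u g \<otimes>\<^bsub>R\<^esub> u g = u g"
    and u_central: "\<lbrakk>g \<in> carrier G; r \<in> carrier R\<rbrakk> \<Longrightarrow> u g \<otimes>\<^bsub>R\<^esub> r = r \<otimes>\<^bsub>R\<^esub> u g"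
    and D_generated: "g \<in> carrier G \<Longrightarrow> D g = Idl\<^bsub>R\<^esub> {u g}"
    and \<alpha>_iso: "g \<in> carrier G \<Longrightarrow>
      \<alpha> g \<in> ring_iso (ideal_ring R (D (inv\<^bsub>G\<^esub> g)) (u (inv\<^bsub>G\<^esub> g))) (ideal_ring R (D g) (u g))"
    and w_invertible: "\<lbrakk>g \<in> carrier G; h \<in> carrier G\<rbrakk> \<Longrightarrow>
      w g h \<in> Units (ideal_ring R (D g \<cdot>\<^bsub>R\<^esub> D (g \<otimes>\<^bsub>G\<^esub> h)) (u g \<otimes>\<^bsub>R\<^esub> u (g \<otimes>\<^bsub>G\<^esub> h)))"
    and D_square: "g \<in> carrier G \<Longrightarrow> D g \<cdot>\<^bsub>R\<^esub> D g = D g"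
    and D_commute: "\<lbrakk>g \<in> carrier G; h \<in> carrier G\<rbrakk> \<Longrightarrow> D g \<cdot>\<^bsub>R\<^esub> D h = D h \<cdot>\<^bsub>R\<^esub> D g"
    and D_one: "D \<one>\<^bsub>G\<^esub> = carrier R"
    and \<alpha>_one: "a \<in> carrier R \<Longrightarrow> \<alpha> \<one>\<^bsub>G\<^esub> a = a"
    and \<alpha>_image: "\<lbrakk>g \<in> carrier G; h \<in> carrier G\<rbrakk> \<Longrightarrow>
      \<alpha> g ` (D (inv\<^bsub>G\<^esub> g) \<cdot>\<^bsub>R\<^esub> D h) = D g \<cdot>\<^bsub>R\<^esub> D (g \<otimes>\<^bsub>G\<^esub> h)"
    and \<alpha>_twist: "\<lbrakk>g \<in> carrier G; h \<in> carrier G;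
        a \<in> D (inv\<^bsub>G\<^esub> h) \<cdot>\<^bsub>R\<^esub> D (inv\<^bsub>G\<^esub> h \<otimes>\<^bsub>G\<^esub> inv\<^bsub>G\<^esub> g)\<rbrakk> \<Longrightarrow>
      \<alpha> g (\<alpha> h a) = w g h \<otimes>\<^bsub>R\<^esub> \<alpha> (g \<otimes>\<^bsub>G\<^esub> h) a \<otimes>\<^bsub>R\<^esub>
        m_inv (ideal_ring R (D g \<cdot>\<^bsub>R\<^esub> D (g \<otimes>\<^bsub>G\<^esub> h)) (u g \<otimes>\<^bsub>R\<^esub> u (g \<otimes>\<^bsub>G\<^esub> h))) (w g h)"
    and w_one_right: "g \<in> carrier G \<Longrightarrow> w g \<one>\<^bsub>G\<^esub> = u g"
    and w_one_left: "g \<in> carrier G \<Longrightarrow> w \<one>\<^bsub>G\<^esub> g = u g"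
    and w_cocycle: "\<lbrakk>g \<in> carrier G; h \<in> carrier G; t \<in> carrier G;
        a \<in> D (inv\<^bsub>G\<^esub> g) \<cdot>\<^bsub>R\<^esub> D h \<cdot>\<^bsub>R\<^esub> D (h \<otimes>\<^bsub>G\<^esub> t)\<rbrakk> \<Longrightarrow>
      \<alpha> g (a \<otimes>\<^bsub>R\<^esub> w h t) \<otimes>\<^bsub>R\<^esub> w g (h \<otimes>\<^bsub>G\<^esub> t) =
        \<alpha> g a \<otimes>\<^bsub>R\<^esub> w g h \<otimes>\<^bsub>R\<^esub> w (g \<otimes>\<^bsub>G\<^esub> h) t"

text \<open>
  A formal sum of terms \<open>a\<^sub>g \<delta>\<^sub>g\<close> is the finitely supported family of its coefficients. In the
  product, the coefficient at \<open>k\<close> collects the terms with \<open>h = g\<^sup>-\<^sup>1 k\<close>.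
\<close>

definition crossed_product ::
  "('g, 'n) monoid_scheme \<Rightarrow> ('r, 'm) ring_scheme \<Rightarrow> ('g \<Rightarrow> 'r set) \<Rightarrow> ('g \<Rightarrow> 'r \<Rightarrow> 'r)
    \<Rightarrow> ('g \<Rightarrow> 'g \<Rightarrow> 'r) \<Rightarrow> ('g \<Rightarrow> 'r) ring" where
  "crossed_product G R D \<alpha> w = \<lparr>
     carrier = {x \<in> \<Pi>\<^sub>E g\<in>carrier G. D g. finite {g \<in> carrier G. x g \<noteq> \<zero>\<^bsub>R\<^esub>}},
     mult = (\<lambda>x y. \<lambda>k\<in>carrier G.
       \<Oplus>\<^bsub>R\<^esub>g\<in>{g \<in> carrier G. x g \<noteq> \<zero>\<^bsub>R\<^esub>}.
         \<alpha> g (inv_into (D (inv\<^bsub>G\<^esub> g)) (\<alpha> g) (x g) \<otimes>\<^bsub>R\<^esub> y (inv\<^bsub>G\<^esub> g \<otimes>\<^bsub>G\<^esub> k))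
           \<otimes>\<^bsub>R\<^esub> w g (inv\<^bsub>G\<^esub> g \<otimes>\<^bsub>G\<^esub> k)),
     one = (\<lambda>g\<in>carrier G. if g = \<one>\<^bsub>G\<^esub> then \<one>\<^bsub>R\<^esub> else \<zero>\<^bsub>R\<^esub>),
     zero = (\<lambda>g\<in>carrier G. \<zero>\<^bsub>R\<^esub>),
     add = (\<lambda>x y. \<lambda>g\<in>carrier G. x g \<oplus>\<^bsub>R\<^esub> y g)\<rparr>"

text \<open>The copy \<open>R \<delta>\<^sub>e\<close> of \<open>R\<close> inside the crossed product.\<close>

definition base_ring_copy ::
  "('g, 'n) monoid_scheme \<Rightarrow> ('r, 'm) ring_scheme \<Rightarrow> ('g \<Rightarrow> 'r) set" where
  "base_ring_copy G R =
     (\<lambda>r. \<lambda>g\<in>carrier G. if g = \<one>\<^bsub>G\<^esub> then r else \<zero>\<^bsub>R\<^esub>) ` carrier R"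

definition centralizer :: "('s, 'm) ring_scheme \<Rightarrow> 's set \<Rightarrow> 's set" where
  "centralizer S Y = {s \<in> carrier S. \<forall>y\<in>Y. s \<otimes>\<^bsub>S\<^esub> y = y \<otimes>\<^bsub>S\<^esub> s}"

definition maximal_commutative :: "'s set \<Rightarrow> ('s, 'm) ring_scheme \<Rightarrow> bool" where
  "maximal_commutative Y S \<longleftrightarrow> Y = centralizer S Y"

definition invariant_ideal ::
  "('g, 'n) monoid_scheme \<Rightarrow> ('r, 'm) ring_scheme \<Rightarrow> ('g \<Rightarrow> 'r set) \<Rightarrow> ('g \<Rightarrow> 'r \<Rightarrow> 'r)
    \<Rightarrow> 'r set \<Rightarrow> bool" where
  "invariant_ideal G R D \<alpha> I \<longleftrightarrow>
     ideal I R \<and> (\<forall>g\<in>carrier G. \<alpha> g ` (I \<inter> D (inv\<^bsub>G\<^esub> g)) \<subseteq> I \<inter> D g)"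

definition action_simple ::
  "('g, 'n) monoid_scheme \<Rightarrow> ('r, 'm) ring_scheme \<Rightarrow> ('g \<Rightarrow> 'r set) \<Rightarrow> ('g \<Rightarrow> 'r \<Rightarrow> 'r)
    \<Rightarrow> bool" where
  "action_simple G R D \<alpha> \<longleftrightarrow>
     (\<forall>I. invariant_ideal G R D \<alpha> I \<longrightarrow> I = {\<zero>\<^bsub>R\<^esub>} \<or> I = carrier R)"

text \<open>
  The zero ring counts as simple, just as \<^const>\<open>action_simple\<close> does not exclude the zero
  ring; the crossed product is zero exactly when \<open>R\<close> is.
\<close>

definition simple_ring :: "('s, 'm) ring_scheme \<Rightarrow> bool" where
  "simple_ring S \<longleftrightarrow> ring S \<and> (\<forall>I. ideal I S \<longrightarrow> I = {\<zero>\<^bsub>S\<^esub>} \<or> I = carrier S)"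

end

theory Submission
  imports Defs
begin

text \<open>
  Put \<open>T\<^sub>g r = \<alpha>\<^sub>g (1\<^bsub>g\<^sup>-\<^sup>1\<^esub> r)\<close>, an additive and multiplicative map \<open>R \<rightarrow> D\<^sub>g\<close>. The product becomes
  \<open>(a \<delta>\<^sub>g) (b \<delta>\<^sub>h) = a T\<^sub>g(b) w\<^sub>g\<^sub>h \<delta>\<^sub>g\<^sub>h\<close>, and associativity reduces to \<open>T\<^sub>g(T\<^sub>h(c)) w\<^sub>g\<^sub>h = w\<^sub>g\<^sub>h T\<^sub>g\<^sub>h(c)\<close> and
  \<open>T\<^sub>g(w\<^sub>h\<^sub>t) w\<^sub>g\<^sub>,\<^sub>h\<^sub>t = w\<^sub>g\<^sub>h w\<^sub>g\<^sub>h\<^sub>,\<^sub>t\<close>, which hold without restriction on \<open>c\<close> because the central idempotents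
  are absorbed by the twist.

  An invariant ideal \<open>I\<close> of \<open>R\<close> extends to the ideal of elements with all coefficients in \<open>I\<close>; so
  simplicity of the crossed product forces \<open>\<alpha>\<close>-simplicity. Conversely, every ideal of the crossed
  product meets \<open>R\<close> in an invariant ideal, and if \<open>R\<close> is maximal commutative, a nonzero ideal meets
  it nontrivially by a minimal support argument.
\<close>

section \<open>Finite sums in abelian monoids and in ideals\<close>

lemma (in abelian_monoid) finsum_swap:
  assumes "finite A" "finite B" "\<And>a b. \<lbrakk>a \<in> A; b \<in> B\<rbrakk> \<Longrightarrow> f a b \<in> carrier G"
  shows "(\<Oplus>a\<in>A. \<Oplus>b\<in>B. f a b) = (\<Oplus>b\<in>B. \<Oplus>a\<in>A. f a b)"
  using assms
proof (induction A rule: finite_induct)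
  case empty
  then show ?case by (simp add: finsum_zero)
next
  case (insert a A)
  have "(\<Oplus>a'\<in>insert a A. \<Oplus>b\<in>B. f a' b) = (\<Oplus>b\<in>B. f a b) \<oplus> (\<Oplus>b\<in>B. \<Oplus>a\<in>A. f a b)"
    using insert by (subst finsum_insert) (auto intro!: finsum_closed)
  also have "\<dots> = (\<Oplus>b\<in>B. f a b \<oplus> (\<Oplus>a\<in>A. f a b))"
    using insert.prems by (subst finsum_addf) (auto intro!: finsum_closed)
  also have "\<dots> = (\<Oplus>b\<in>B. \<Oplus>a'\<in>insert a A. f a' b)"
    using insert by (intro finsum_cong') (auto intro!: finsum_closed)
  finally show ?case .
qed

lemma (in ideal) finsum_in_ideal:
  assumes "finite A" "\<And>i. i \<in> A \<Longrightarrow> f i \<in> I"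
  shows "(\<Oplus>i\<in>A. f i) \<in> I"
  using assms
proof (induction A rule: finite_induct)
  case empty
  then show ?case by simp
next
  case (insert i A)
  then have "f \<in> A \<rightarrow> carrier R" "f i \<in> carrier R"
    by (auto intro: Icarr)
  with insert show ?case by simp
qed

context unital_twisted_partial_action
begin

subsection \<open>Extending the partial isomorphisms to \<open>R\<close>\<close>

lemma D_iff:
  assumes "g \<in> carrier G"
  shows "x \<in> D g \<longleftrightarrow> x \<in> carrier R \<and> x \<otimes>\<^bsub>R\<^esub> u g = x"
proof -
  let ?I = "{x \<in> carrier R. x \<otimes>\<^bsub>R\<^esub> u g = x}"
  interpret D: ideal "D g" R by (rule D_ideal[OF assms])
  note [simp] = u_closed[OF assms]
  \<comment> \<open>The fixed elements form a two-sided ideal because \<open>u g\<close> is central,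
    and \<open>u g\<close> is one of them by idempotence, so the generated ideal lies in
    \<open>?I\<close>. Conversely, a fixed \<open>x\<close> equals \<open>x \<otimes> u g\<close>, a
    multiple of the generator.\<close>
  have "ideal ?I R"
  proof (rule idealI)
    show "ring R" by (rule R.ring_axioms)
    show "subgroup ?I (add_monoid R)"
    proof (rule R.add.subgroupI)
      fix a assume "a \<in> ?I"
      then show "\<ominus>\<^bsub>R\<^esub> a \<in> ?I" by (simp add: R.l_minus)
    qed (auto simp: R.l_distr intro!: exI[of _ "\<zero>\<^bsub>R\<^esub>"])
  next
    fix a x assume "a \<in> ?I" "x \<in> carrier R"
    then show "x \<otimes>\<^bsub>R\<^esub> a \<in> ?I" "a \<otimes>\<^bsub>R\<^esub> x \<in> ?I"
      using u_central[OF assms] by (auto simp: R.m_assoc) (metis R.m_assoc \<open>u g \<in> carrier R\<close>)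
  qed
  then have "D g \<subseteq> ?I"
    unfolding D_generated[OF assms] by (rule R.genideal_minimal) (simp add: u_idem assms)
  moreover have "u g \<in> D g"
    unfolding D_generated[OF assms] by (rule R.genideal_self') simp
  then have "?I \<subseteq> D g"
    using D.I_l_closed by force
  ultimately show ?thesis by blast
qed

lemma D_closed: "\<lbrakk>g \<in> carrier G; x \<in> D g\<rbrakk> \<Longrightarrow> x \<in> carrier R"
  by (simp add: D_iff)

lemma D_mult_u: "\<lbrakk>g \<in> carrier G; x \<in> D g\<rbrakk> \<Longrightarrow> x \<otimes>\<^bsub>R\<^esub> u g = x"
  by (simp add: D_iff)

lemma D_u_mult: "\<lbrakk>g \<in> carrier G; x \<in> D g\<rbrakk> \<Longrightarrow> u g \<otimes>\<^bsub>R\<^esub> x = x"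
  by (simp add: D_iff u_central)

lemma u_in_D: "g \<in> carrier G \<Longrightarrow> u g \<in> D g"
  by (simp add: D_iff u_closed u_idem)

lemma D_l_mult: "\<lbrakk>g \<in> carrier G; x \<in> D g; r \<in> carrier R\<rbrakk> \<Longrightarrow> r \<otimes>\<^bsub>R\<^esub> x \<in> D g"
  by (rule ideal.I_l_closed[OF D_ideal])

lemma D_r_mult: "\<lbrakk>g \<in> carrier G; x \<in> D g; r \<in> carrier R\<rbrakk> \<Longrightarrow> x \<otimes>\<^bsub>R\<^esub> r \<in> D g"
  by (rule ideal.I_r_closed[OF D_ideal])

lemma zero_in_D: "g \<in> carrier G \<Longrightarrow> \<zero>\<^bsub>R\<^esub> \<in> D g"
  by (simp add: D_iff u_closed)

lemma D_add: "\<lbrakk>g \<in> carrier G; x \<in> D g; y \<in> D g\<rbrakk> \<Longrightarrow> x \<oplus>\<^bsub>R\<^esub> y \<in> D g"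
  by (simp add: D_iff u_closed R.l_distr)

lemma D_a_inv: "\<lbrakk>g \<in> carrier G; x \<in> D g\<rbrakk> \<Longrightarrow> \<ominus>\<^bsub>R\<^esub> x \<in> D g"
  by (simp add: D_iff u_closed R.l_minus)

text \<open>If \<open>x\<close> lies in both ideals, then \<open>x = x \<otimes> u h\<close>
  displays it as a single product. The product ideals in the axioms thus reduce to pairs of
  membership conditions.\<close>

lemma ideal_prod_D_iff:
  assumes "g \<in> carrier G" "h \<in> carrier G"
  shows "x \<in> D g \<cdot>\<^bsub>R\<^esub> D h \<longleftrightarrow> x \<in> D g \<and> x \<in> D h"
proof
  assume "x \<in> D g \<cdot>\<^bsub>R\<^esub> D h"
  then show "x \<in> D g \<and> x \<in> D h"
    using R.ideal_prod_inter[OF D_ideal D_ideal] assms by blast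
next
  assume x: "x \<in> D g \<and> x \<in> D h"
  then have "x \<otimes>\<^bsub>R\<^esub> u h \<in> D g \<cdot>\<^bsub>R\<^esub> D h"
    by (intro ideal_prod.prod u_in_D assms) auto
  with x show "x \<in> D g \<cdot>\<^bsub>R\<^esub> D h"
    by (simp add: D_mult_u assms)
qed

section \<open>The isomorphisms \<open>\<alpha> g\<close> and their extensions to
  \<open>R\<close>\<close>

lemma \<alpha>_bij: "g \<in> carrier G \<Longrightarrow> bij_betw (\<alpha> g) (D (inv\<^bsub>G\<^esub> g)) (D g)"
  using \<alpha>_iso[of g] by (simp add: ring_iso_def ideal_ring_def)

lemma \<alpha>_closed: "\<lbrakk>g \<in> carrier G; a \<in> D (inv\<^bsub>G\<^esub> g)\<rbrakk> \<Longrightarrow> \<alpha> g a \<in> D g"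
  using \<alpha>_bij bij_betwE by blast

lemma \<alpha>_mult: "\<lbrakk>g \<in> carrier G; a \<in> D (inv\<^bsub>G\<^esub> g); b \<in> D (inv\<^bsub>G\<^esub> g)\<rbrakk>
    \<Longrightarrow> \<alpha> g (a \<otimes>\<^bsub>R\<^esub> b) = \<alpha> g a \<otimes>\<^bsub>R\<^esub> \<alpha> g b"
  using \<alpha>_iso[of g] by (simp add: ring_iso_def ring_hom_def ideal_ring_def)

lemma \<alpha>_add: "\<lbrakk>g \<in> carrier G; a \<in> D (inv\<^bsub>G\<^esub> g); b \<in> D (inv\<^bsub>G\<^esub> g)\<rbrakk>
    \<Longrightarrow> \<alpha> g (a \<oplus>\<^bsub>R\<^esub> b) = \<alpha> g a \<oplus>\<^bsub>R\<^esub> \<alpha> g b"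
  using \<alpha>_iso[of g] by (simp add: ring_iso_def ring_hom_def ideal_ring_def)

lemma \<alpha>_u: "g \<in> carrier G \<Longrightarrow> \<alpha> g (u (inv\<^bsub>G\<^esub> g)) = u g"
  using \<alpha>_iso[of g] by (simp add: ring_iso_def ring_hom_def ideal_ring_def)

text \<open>Cutting the argument down by \<open>u (inv g)\<close> first gives a map that is additive
  and multiplicative on all of \<open>R\<close>, so later computations need no membership in
  \<open>D (inv g)\<close>.\<close>

definition T :: "'g \<Rightarrow> 'r \<Rightarrow> 'r" where
  "T g r = \<alpha> g (u (inv\<^bsub>G\<^esub> g) \<otimes>\<^bsub>R\<^esub> r)"

lemma u_mult_in_D: "\<lbrakk>g \<in> carrier G; r \<in> carrier R\<rbrakk> \<Longrightarrow> u g \<otimes>\<^bsub>R\<^esub> r \<in> D g"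
  by (intro D_r_mult u_in_D)

lemma T_in_D: "\<lbrakk>g \<in> carrier G; r \<in> carrier R\<rbrakk> \<Longrightarrow> T g r \<in> D g"
  by (simp add: T_def \<alpha>_closed u_mult_in_D)

lemma T_closed: "\<lbrakk>g \<in> carrier G; r \<in> carrier R\<rbrakk> \<Longrightarrow> T g r \<in> carrier R"
  using T_in_D D_closed by blast

lemma T_on_D: "\<lbrakk>g \<in> carrier G; r \<in> D (inv\<^bsub>G\<^esub> g)\<rbrakk> \<Longrightarrow> T g r = \<alpha> g r"
  by (simp add: T_def D_u_mult)

lemma T_add: "\<lbrakk>g \<in> carrier G; r \<in> carrier R; s \<in> carrier R\<rbrakk>
    \<Longrightarrow> T g (r \<oplus>\<^bsub>R\<^esub> s) = T g r \<oplus>\<^bsub>R\<^esub> T g s"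
  by (simp add: T_def R.r_distr u_closed \<alpha>_add u_mult_in_D)

lemma T_mult:
  assumes "g \<in> carrier G" "r \<in> carrier R" "s \<in> carrier R"
  shows "T g (r \<otimes>\<^bsub>R\<^esub> s) = T g r \<otimes>\<^bsub>R\<^esub> T g s"
proof -
  let ?v = "u (inv\<^bsub>G\<^esub> g)"
  have v: "?v \<in> carrier R" using assms by (simp add: u_closed)
  \<comment> \<open>The factor \<open>?v\<close> is doubled by idempotence, and one copy is moved
    past \<open>r\<close> by centrality.\<close>
  have "?v \<otimes>\<^bsub>R\<^esub> (r \<otimes>\<^bsub>R\<^esub> s) = (?v \<otimes>\<^bsub>R\<^esub> r) \<otimes>\<^bsub>R\<^esub> (?v \<otimes>\<^bsub>R\<^esub> s)"
    using u_central[of "inv\<^bsub>G\<^esub> g" r] u_idem[of "inv\<^bsub>G\<^esub> g"] assms v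
    by (metis G.inv_closed R.m_assoc R.m_closed)
  then show ?thesis
    using assms by (simp add: T_def \<alpha>_mult u_mult_in_D)
qed

lemma T_one: "g \<in> carrier G \<Longrightarrow> T g \<one>\<^bsub>R\<^esub> = u g"
  by (simp add: T_def u_closed \<alpha>_u)

lemma T_zero: "g \<in> carrier G \<Longrightarrow> T g \<zero>\<^bsub>R\<^esub> = \<zero>\<^bsub>R\<^esub>"
  using T_add[of g "\<zero>\<^bsub>R\<^esub>" "\<zero>\<^bsub>R\<^esub>"] T_closed[of g "\<zero>\<^bsub>R\<^esub>"]
  by (simp add: R.add.l_cancel_one')

lemma u_one: "u \<one>\<^bsub>G\<^esub> = \<one>\<^bsub>R\<^esub>"
  using D_u_mult[of "\<one>\<^bsub>G\<^esub>" "\<one>\<^bsub>R\<^esub>"] by (simp add: D_one u_closed)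

lemma T_id: "r \<in> carrier R \<Longrightarrow> T \<one>\<^bsub>G\<^esub> r = r"
  by (simp add: T_def u_one \<alpha>_one)

text \<open>\<open>\<alpha> g\<close> maps \<open>D (inv g) \<cdot> D h\<close> multiplicatively
  onto \<open>D g \<cdot> D (g h)\<close>, so it carries identity to identity. Concretely,
  \<open>?p \<otimes> \<alpha> g ?a\<close> is evaluated in two ways: \<open>?a\<close> is an
  identity for the preimage \<open>b\<close> of \<open>?p\<close>, and \<open>?p\<close> is an
  identity for \<open>\<alpha> g ?a\<close>.\<close>

lemma T_u:
  assumes g: "g \<in> carrier G" and h: "h \<in> carrier G"
  shows "T g (u h) = u g \<otimes>\<^bsub>R\<^esub> u (g \<otimes>\<^bsub>G\<^esub> h)"
proof -
  let ?a = "u (inv\<^bsub>G\<^esub> g) \<otimes>\<^bsub>R\<^esub> u h" and ?p = "u g \<otimes>\<^bsub>R\<^esub> u (g \<otimes>\<^bsub>G\<^esub> h)"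
  have a: "?a \<in> D (inv\<^bsub>G\<^esub> g) \<cdot>\<^bsub>R\<^esub> D h"
    using assms by (intro ideal_prod.prod u_in_D) auto
  have "\<alpha> g ?a \<in> D g \<cdot>\<^bsub>R\<^esub> D (g \<otimes>\<^bsub>G\<^esub> h)"
    using a \<alpha>_image[OF g h] by blast
  then have e: "\<alpha> g ?a \<in> D g" "\<alpha> g ?a \<in> D (g \<otimes>\<^bsub>G\<^esub> h)"
    using assms by (auto simp: ideal_prod_D_iff)
  have "?p \<in> \<alpha> g ` (D (inv\<^bsub>G\<^esub> g) \<cdot>\<^bsub>R\<^esub> D h)"
    using assms by (simp add: \<alpha>_image ideal_prod.prod u_in_D)
  then obtain b where b: "b \<in> D (inv\<^bsub>G\<^esub> g)" "b \<in> D h" "?p = \<alpha> g b"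
    using assms by (auto simp: ideal_prod_D_iff)
  have "b \<otimes>\<^bsub>R\<^esub> ?a = b"
    using b assms D_closed[OF h b(2)]
    by (simp add: R.m_assoc[symmetric] u_closed D_mult_u)
  then have "?p \<otimes>\<^bsub>R\<^esub> \<alpha> g ?a = ?p"
    using \<alpha>_mult[OF g b(1), of ?a] a b(3) g h by (simp add: ideal_prod_D_iff)
  moreover have "?p \<otimes>\<^bsub>R\<^esub> \<alpha> g ?a = \<alpha> g ?a"
    using e assms D_closed[OF g e(1)] by (simp add: R.m_assoc u_closed D_u_mult)
  ultimately show ?thesis by (simp add: T_def)
qed

section \<open>The units \<open>w g h\<close> and the identities behind associativity\<close>

lemma ideal_ring_D_monoid:
  assumes g: "g \<in> carrier G" and h: "h \<in> carrier G"
  shows "monoid (ideal_ring R (D g \<cdot>\<^bsub>R\<^esub> D h) (u g \<otimes>\<^bsub>R\<^esub> u h))"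
proof (rule monoidI, simp_all add: ideal_ring_def)
  fix x y z assume *: "x \<in> D g \<cdot>\<^bsub>R\<^esub> D h" "y \<in> D g \<cdot>\<^bsub>R\<^esub> D h"
  have **: "x \<in> D g" "x \<in> D h" "x \<in> carrier R" "y \<in> carrier R"
    using * assms D_closed by (auto simp: ideal_prod_D_iff)
  then show "x \<otimes>\<^bsub>R\<^esub> y \<in> D g \<cdot>\<^bsub>R\<^esub> D h"
    using assms by (simp add: ideal_prod_D_iff D_r_mult)
  show "u g \<otimes>\<^bsub>R\<^esub> u h \<otimes>\<^bsub>R\<^esub> x = x" "x \<otimes>\<^bsub>R\<^esub> (u g \<otimes>\<^bsub>R\<^esub> u h) = x"
    using ** assms by (simp_all add: R.m_assoc u_closed D_u_mult)
      (simp add: R.m_assoc[symmetric] u_closed D_mult_u)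
  assume "z \<in> D g \<cdot>\<^bsub>R\<^esub> D h"
  then have "z \<in> carrier R"
    using assms D_closed by (auto simp: ideal_prod_D_iff)
  with ** show "x \<otimes>\<^bsub>R\<^esub> y \<otimes>\<^bsub>R\<^esub> z = x \<otimes>\<^bsub>R\<^esub> (y \<otimes>\<^bsub>R\<^esub> z)"
    by (simp add: R.m_assoc)
qed (use assms in \<open>simp add: ideal_prod.prod u_in_D\<close>)

lemma w_in_D:
  assumes "g \<in> carrier G" "h \<in> carrier G"
  shows "w g h \<in> D g" "w g h \<in> D (g \<otimes>\<^bsub>G\<^esub> h)"
  using w_invertible[OF assms] assms
  by (auto simp: Units_def ideal_ring_def ideal_prod_D_iff)

lemma w_closed: "\<lbrakk>g \<in> carrier G; h \<in> carrier G\<rbrakk> \<Longrightarrow> w g h \<in> carrier R"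
  using w_in_D D_closed by blast

text \<open>Written exactly as the inverse in \<open>\<alpha>_twist\<close>, which is taken in the
  ring \<open>D g \<cdot> D (g h)\<close> and not in \<open>R\<close>.\<close>

abbreviation w_inv :: "'g \<Rightarrow> 'g \<Rightarrow> 'r" where
  "w_inv g h \<equiv>
    m_inv (ideal_ring R (D g \<cdot>\<^bsub>R\<^esub> D (g \<otimes>\<^bsub>G\<^esub> h)) (u g \<otimes>\<^bsub>R\<^esub> u (g \<otimes>\<^bsub>G\<^esub> h))) (w g h)"

lemma w_inv:
  assumes g: "g \<in> carrier G" and h: "h \<in> carrier G"
  shows w_inv_closed: "w_inv g h \<in> carrier R"
    and w_inv_l: "w_inv g h \<otimes>\<^bsub>R\<^esub> w g h = u g \<otimes>\<^bsub>R\<^esub> u (g \<otimes>\<^bsub>G\<^esub> h)"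
    and w_inv_r: "w g h \<otimes>\<^bsub>R\<^esub> w_inv g h = u g \<otimes>\<^bsub>R\<^esub> u (g \<otimes>\<^bsub>G\<^esub> h)"
proof -
  let ?M = "ideal_ring R (D g \<cdot>\<^bsub>R\<^esub> D (g \<otimes>\<^bsub>G\<^esub> h)) (u g \<otimes>\<^bsub>R\<^esub> u (g \<otimes>\<^bsub>G\<^esub> h))"
  interpret M: monoid ?M
    using assms by (simp add: ideal_ring_D_monoid)
  note U = w_invertible[OF assms]
  have "w_inv g h \<in> D g \<cdot>\<^bsub>R\<^esub> D (g \<otimes>\<^bsub>G\<^esub> h)"
    using M.Units_inv_closed[OF U] by (simp add: ideal_ring_def)
  then show "w_inv g h \<in> carrier R"
    using assms D_closed[OF g] by (auto simp: ideal_prod_D_iff)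
  show "w_inv g h \<otimes>\<^bsub>R\<^esub> w g h = u g \<otimes>\<^bsub>R\<^esub> u (g \<otimes>\<^bsub>G\<^esub> h)"
    using M.Units_l_inv[OF U] by (simp add: ideal_ring_def)
  show "w g h \<otimes>\<^bsub>R\<^esub> w_inv g h = u g \<otimes>\<^bsub>R\<^esub> u (g \<otimes>\<^bsub>G\<^esub> h)"
    using M.Units_r_inv[OF U] by (simp add: ideal_ring_def)
qed

text \<open>\<open>\<alpha>_twist\<close> covers only arguments in
  \<open>D (inv h) \<cdot> D (inv h inv g)\<close>. Multiplying \<open>c\<close> by the identity
  \<open>?a\<close> of that ideal moves it there; this introduces only idempotents that
  \<open>w g h\<close> or the maps \<open>T\<close> absorb, and right multiplication by
  \<open>w g h\<close> clears the inverse.\<close>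

lemma T_twist:
  assumes g: "g \<in> carrier G" and h: "h \<in> carrier G" and c: "c \<in> carrier R"
  shows "T g (T h c) \<otimes>\<^bsub>R\<^esub> w g h = w g h \<otimes>\<^bsub>R\<^esub> T (g \<otimes>\<^bsub>G\<^esub> h) c"
proof -
  let ?gh = "g \<otimes>\<^bsub>G\<^esub> h"
  let ?a = "u (inv\<^bsub>G\<^esub> h) \<otimes>\<^bsub>R\<^esub> u (inv\<^bsub>G\<^esub> ?gh)"
  have gh: "inv\<^bsub>G\<^esub> ?gh = inv\<^bsub>G\<^esub> h \<otimes>\<^bsub>G\<^esub> inv\<^bsub>G\<^esub> g"
    using g h by (rule G.inv_mult_group)
  have [simp]: "u g \<in> carrier R" "u h \<in> carrier R" "u ?gh \<in> carrier R"
      "u (inv\<^bsub>G\<^esub> g) \<in> carrier R" "u (inv\<^bsub>G\<^esub> h) \<in> carrier R" "u (inv\<^bsub>G\<^esub> ?gh) \<in> carrier R"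
      "T ?gh c \<in> carrier R" "w g h \<in> carrier R" "T h c \<in> carrier R"
    using g h c by (simp_all add: u_closed T_closed w_closed)
  have a: "?a \<in> D (inv\<^bsub>G\<^esub> h)" "?a \<in> D (inv\<^bsub>G\<^esub> ?gh)"
    using g h by (simp_all add: u_mult_in_D D_l_mult u_in_D)
  have ac: "?a \<otimes>\<^bsub>R\<^esub> c \<in> D (inv\<^bsub>G\<^esub> h)" "?a \<otimes>\<^bsub>R\<^esub> c \<in> D (inv\<^bsub>G\<^esub> ?gh)"
    using g h c by (auto intro!: D_r_mult a)
  \<comment> \<open>By \<open>T_u\<close>, \<open>T h\<close> sends \<open>?a\<close> to a product
    of idempotents: \<open>u h\<close> is absorbed by \<open>T h c\<close>, and
    \<open>u (inv g)\<close> is the factor already built into \<open>T g\<close>.\<close>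
  have "T h ?a = u (inv\<^bsub>G\<^esub> g) \<otimes>\<^bsub>R\<^esub> u h"
  proof -
    have "T h ?a = T h (u (inv\<^bsub>G\<^esub> h)) \<otimes>\<^bsub>R\<^esub> T h (u (inv\<^bsub>G\<^esub> ?gh))"
      using h by (simp add: T_mult)
    also have "h \<otimes>\<^bsub>G\<^esub> inv\<^bsub>G\<^esub> ?gh = inv\<^bsub>G\<^esub> g"
      using g h by (simp add: gh G.m_assoc[symmetric])
    then have "T h (u (inv\<^bsub>G\<^esub> ?gh)) = u h \<otimes>\<^bsub>R\<^esub> u (inv\<^bsub>G\<^esub> g)"
      using T_u[of h "inv\<^bsub>G\<^esub> ?gh"] g h by simp
    also have "T h (u (inv\<^bsub>G\<^esub> h)) = u h"
      using h by (simp add: T_u u_one)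
    finally have "T h ?a = u h \<otimes>\<^bsub>R\<^esub> u (inv\<^bsub>G\<^esub> g)"
      using h by (simp add: R.m_assoc[symmetric] u_idem)
    also have "\<dots> = u (inv\<^bsub>G\<^esub> g) \<otimes>\<^bsub>R\<^esub> u h"
      using h by (simp add: u_central)
    finally show ?thesis .
  qed
  moreover have "\<alpha> h (?a \<otimes>\<^bsub>R\<^esub> c) = T h ?a \<otimes>\<^bsub>R\<^esub> T h c"
    using h c T_on_D[OF h ac(1)] T_mult[of h ?a c] by simp
  ultimately have "\<alpha> h (?a \<otimes>\<^bsub>R\<^esub> c) = u (inv\<^bsub>G\<^esub> g) \<otimes>\<^bsub>R\<^esub> T h c"
    using h c by (simp add: R.m_assoc D_u_mult T_in_D)
  then have "T g (T h c) = \<alpha> g (\<alpha> h (?a \<otimes>\<^bsub>R\<^esub> c))"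
    by (simp add: T_def[of g])
  also have "\<dots> = w g h \<otimes>\<^bsub>R\<^esub> \<alpha> ?gh (?a \<otimes>\<^bsub>R\<^esub> c) \<otimes>\<^bsub>R\<^esub> w_inv g h"
    using ac g h by (intro \<alpha>_twist) (simp_all add: gh[symmetric] ideal_prod_D_iff)
  also have "\<alpha> ?gh (?a \<otimes>\<^bsub>R\<^esub> c) = u g \<otimes>\<^bsub>R\<^esub> T ?gh c"
  proof -
    have "T ?gh ?a = T ?gh (u (inv\<^bsub>G\<^esub> h)) \<otimes>\<^bsub>R\<^esub> T ?gh (u (inv\<^bsub>G\<^esub> ?gh))"
      using g h by (simp add: T_mult)
    also have "?gh \<otimes>\<^bsub>G\<^esub> inv\<^bsub>G\<^esub> h = g"
      using g h by (simp add: G.m_assoc)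
    then have "T ?gh (u (inv\<^bsub>G\<^esub> h)) = u ?gh \<otimes>\<^bsub>R\<^esub> u g"
      using g h by (simp add: T_u)
    also have "T ?gh (u (inv\<^bsub>G\<^esub> ?gh)) = u ?gh"
      using g h by (simp add: T_u u_one)
    also have "u ?gh \<otimes>\<^bsub>R\<^esub> u g = u g \<otimes>\<^bsub>R\<^esub> u ?gh"
      using g h by (intro u_central) auto
    finally have "T ?gh ?a = u g \<otimes>\<^bsub>R\<^esub> u ?gh"
      using g h by (simp add: R.m_assoc u_idem)
    moreover have "\<alpha> ?gh (?a \<otimes>\<^bsub>R\<^esub> c) = T ?gh ?a \<otimes>\<^bsub>R\<^esub> T ?gh c"
      using g h c T_on_D[OF _ ac(2)] T_mult[of ?gh ?a c] by simp
    ultimately show ?thesis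
      using g h c by (simp add: R.m_assoc D_u_mult T_in_D)
  qed
  finally have "T g (T h c) \<otimes>\<^bsub>R\<^esub> w g h
      = w g h \<otimes>\<^bsub>R\<^esub> (u g \<otimes>\<^bsub>R\<^esub> T ?gh c) \<otimes>\<^bsub>R\<^esub> (u g \<otimes>\<^bsub>R\<^esub> u ?gh)"
    using g h w_inv_closed[OF g h] by (simp add: R.m_assoc w_inv_l)
  \<comment> \<open>The inner \<open>u g\<close> vanishes into \<open>w g h\<close>; the outer one
    is commuted back to the same place and vanishes too, and \<open>u ?gh\<close> is absorbed by
    \<open>T ?gh c\<close>.\<close>
  also have "\<dots> = w g h \<otimes>\<^bsub>R\<^esub> (T ?gh c \<otimes>\<^bsub>R\<^esub> u g) \<otimes>\<^bsub>R\<^esub> u ?gh"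
    using g h by (simp add: R.m_assoc[symmetric] D_mult_u w_in_D)
  also have "T ?gh c \<otimes>\<^bsub>R\<^esub> u g = u g \<otimes>\<^bsub>R\<^esub> T ?gh c"
    using g by (simp add: u_central)
  also have "w g h \<otimes>\<^bsub>R\<^esub> (u g \<otimes>\<^bsub>R\<^esub> T ?gh c) = w g h \<otimes>\<^bsub>R\<^esub> T ?gh c"
    using g h by (simp add: R.m_assoc[symmetric] D_mult_u w_in_D)
  also have "w g h \<otimes>\<^bsub>R\<^esub> T ?gh c \<otimes>\<^bsub>R\<^esub> u ?gh = w g h \<otimes>\<^bsub>R\<^esub> T ?gh c"
    using g h c by (simp add: R.m_assoc D_mult_u T_in_D)
  finally show ?thesis .
qed

text \<open>This is \<open>w_cocycle\<close> at the identity \<open>?a\<close> of the ideal over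
  which it quantifies. The factor \<open>w h t\<close> absorbs \<open>u h\<close> and
  \<open>u (h t)\<close> before \<open>\<alpha> g\<close> is applied, and the image of
  \<open>?a\<close> is a product of idempotents that \<open>w g h\<close> and
  \<open>w (g h) t\<close> absorb.\<close>

lemma T_cocycle:
  assumes g: "g \<in> carrier G" and h: "h \<in> carrier G" and t: "t \<in> carrier G"
  shows "T g (w h t) \<otimes>\<^bsub>R\<^esub> w g (h \<otimes>\<^bsub>G\<^esub> t) = w g h \<otimes>\<^bsub>R\<^esub> w (g \<otimes>\<^bsub>G\<^esub> h) t"
proof -
  let ?a = "u (inv\<^bsub>G\<^esub> g) \<otimes>\<^bsub>R\<^esub> u h \<otimes>\<^bsub>R\<^esub> u (h \<otimes>\<^bsub>G\<^esub> t)"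
  let ?gh = "g \<otimes>\<^bsub>G\<^esub> h" and ?ght = "g \<otimes>\<^bsub>G\<^esub> h \<otimes>\<^bsub>G\<^esub> t"
  have [simp]: "u g \<in> carrier R" "u h \<in> carrier R" "u ?gh \<in> carrier R" "u ?ght \<in> carrier R"
      "u (inv\<^bsub>G\<^esub> g) \<in> carrier R" "u (h \<otimes>\<^bsub>G\<^esub> t) \<in> carrier R" "w h t \<in> carrier R"
      "w g h \<in> carrier R" "w ?gh t \<in> carrier R"
    using assms by (simp_all add: u_closed w_closed)
  have a: "?a \<in> D (inv\<^bsub>G\<^esub> g) \<cdot>\<^bsub>R\<^esub> D h \<cdot>\<^bsub>R\<^esub> D (h \<otimes>\<^bsub>G\<^esub> t)"
    using assms by (intro ideal_prod.prod u_in_D) auto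
  have "?a \<otimes>\<^bsub>R\<^esub> w h t = u (inv\<^bsub>G\<^esub> g) \<otimes>\<^bsub>R\<^esub> w h t"
    using assms by (simp add: R.m_assoc D_u_mult w_in_D)
  then have "T g (w h t) = \<alpha> g (?a \<otimes>\<^bsub>R\<^esub> w h t)"
    by (simp add: T_def)
  then have "T g (w h t) \<otimes>\<^bsub>R\<^esub> w g (h \<otimes>\<^bsub>G\<^esub> t) = \<alpha> g ?a \<otimes>\<^bsub>R\<^esub> w g h \<otimes>\<^bsub>R\<^esub> w ?gh t"
    using w_cocycle[OF g h t a] by simp
  also have "\<alpha> g ?a = T g (u h \<otimes>\<^bsub>R\<^esub> u (h \<otimes>\<^bsub>G\<^esub> t))"
    by (simp add: T_def R.m_assoc)
  also have "\<dots> = u g \<otimes>\<^bsub>R\<^esub> u ?gh \<otimes>\<^bsub>R\<^esub> (u g \<otimes>\<^bsub>R\<^esub> u ?ght)"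
    using assms by (simp add: T_mult T_u G.m_assoc)
  \<comment> \<open>The duplicate \<open>u g\<close> is removed and \<open>u ?ght\<close> brought to
    the front: \<open>w g h\<close> then absorbs \<open>u g\<close> and \<open>u ?gh\<close>, while
    \<open>u ?ght\<close> passes it by centrality and meets \<open>w ?gh t\<close>, which lies in
    \<open>D ?ght\<close>.\<close>
  also have "\<dots> = u ?ght \<otimes>\<^bsub>R\<^esub> (u g \<otimes>\<^bsub>R\<^esub> u ?gh)"
  proof -
    have "u g \<otimes>\<^bsub>R\<^esub> u ?gh \<otimes>\<^bsub>R\<^esub> (u g \<otimes>\<^bsub>R\<^esub> u ?ght) = u g \<otimes>\<^bsub>R\<^esub> u ?gh \<otimes>\<^bsub>R\<^esub> u g \<otimes>\<^bsub>R\<^esub> u ?ght"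
      by (simp add: R.m_assoc)
    also have "u g \<otimes>\<^bsub>R\<^esub> u ?gh \<otimes>\<^bsub>R\<^esub> u g = u g \<otimes>\<^bsub>R\<^esub> (u g \<otimes>\<^bsub>R\<^esub> u ?gh)"
      using g by (intro u_central[symmetric]) auto
    also have "\<dots> = u g \<otimes>\<^bsub>R\<^esub> u ?gh"
      using g by (simp add: R.m_assoc[symmetric] u_idem)
    also have "u g \<otimes>\<^bsub>R\<^esub> u ?gh \<otimes>\<^bsub>R\<^esub> u ?ght = u ?ght \<otimes>\<^bsub>R\<^esub> (u g \<otimes>\<^bsub>R\<^esub> u ?gh)"
      using assms by (intro u_central[symmetric]) auto
    finally show ?thesis .
  qed
  also have "u ?ght \<otimes>\<^bsub>R\<^esub> (u g \<otimes>\<^bsub>R\<^esub> u ?gh) \<otimes>\<^bsub>R\<^esub> w g h \<otimes>\<^bsub>R\<^esub> w ?gh t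
      = u ?ght \<otimes>\<^bsub>R\<^esub> w g h \<otimes>\<^bsub>R\<^esub> w ?gh t"
    using assms by (simp add: R.m_assoc D_u_mult D_r_mult w_in_D)
  also have "u ?ght \<otimes>\<^bsub>R\<^esub> w g h = w g h \<otimes>\<^bsub>R\<^esub> u ?ght"
    using assms by (intro u_central) auto
  also have "w g h \<otimes>\<^bsub>R\<^esub> u ?ght \<otimes>\<^bsub>R\<^esub> w ?gh t = w g h \<otimes>\<^bsub>R\<^esub> w ?gh t"
    using assms by (simp add: R.m_assoc D_u_mult w_in_D)
  finally show ?thesis .
qed

text \<open>This translates the product in \<open>crossed_product\<close> into terms of
  \<open>T\<close>. The preimage of \<open>a\<close> is fixed by \<open>u (inv g)\<close>, so
  \<open>b\<close> may be replaced by \<open>u (inv g) \<otimes> b\<close>, to which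
  multiplicativity of \<open>\<alpha> g\<close> applies.\<close>

lemma \<alpha>_inv_into_mult:
  assumes g: "g \<in> carrier G" and a: "a \<in> D g" and b: "b \<in> carrier R"
  shows "\<alpha> g (inv_into (D (inv\<^bsub>G\<^esub> g)) (\<alpha> g) a \<otimes>\<^bsub>R\<^esub> b) = a \<otimes>\<^bsub>R\<^esub> T g b"
proof -
  let ?c = "inv_into (D (inv\<^bsub>G\<^esub> g)) (\<alpha> g) a"
  have c: "?c \<in> D (inv\<^bsub>G\<^esub> g)" "\<alpha> g ?c = a"
    using a bij_betw_imp_surj_on[OF \<alpha>_bij[OF g]] by (simp_all add: inv_into_into f_inv_into_f)
  have "?c \<otimes>\<^bsub>R\<^esub> b = ?c \<otimes>\<^bsub>R\<^esub> (u (inv\<^bsub>G\<^esub> g) \<otimes>\<^bsub>R\<^esub> b)"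
    using g b c(1) D_closed[OF _ c(1)] by (simp add: R.m_assoc[symmetric] u_closed D_mult_u)
  then show ?thesis
    using g b c by (simp add: \<alpha>_mult u_mult_in_D T_def)
qed

subsection \<open>The crossed product is a ring\<close>

lemma T_finsum:
  assumes g: "g \<in> carrier G" and "finite A" "f \<in> A \<rightarrow> carrier R"
  shows "T g (\<Oplus>\<^bsub>R\<^esub>i\<in>A. f i) = (\<Oplus>\<^bsub>R\<^esub>i\<in>A. T g (f i))"
  using assms(2,3)
proof (induction A rule: finite_induct)
  case empty
  then show ?case by (simp add: T_zero g)
next
  case (insert i A)
  then have "f i \<in> carrier R" "f \<in> A \<rightarrow> carrier R" "(\<lambda>i. T g (f i)) \<in> A \<rightarrow> carrier R"
    using T_closed[OF g] by auto
  with insert show ?case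
    using T_closed[OF g] by (simp add: T_add[OF g] R.finsum_closed)
qed

section \<open>Coefficients, supports and the additive group\<close>

abbreviation S :: "('g \<Rightarrow> 'r) ring" where
  "S \<equiv> crossed_product G R D \<alpha> w"

definition supp :: "('g \<Rightarrow> 'r) \<Rightarrow> 'g set" where
  "supp x = {g \<in> carrier G. x g \<noteq> \<zero>\<^bsub>R\<^esub>}"

text \<open>The formal term \<open>a \<delta>\<^sub>g\<close>, extensional like all elements of the
  carrier.\<close>

definition monomial :: "'r \<Rightarrow> 'g \<Rightarrow> 'g \<Rightarrow> 'r" where
  "monomial a g = (\<lambda>k\<in>carrier G. if k = g then a else \<zero>\<^bsub>R\<^esub>)"

lemma supp_subset: "supp x \<subseteq> carrier G"
  by (auto simp: supp_def)

lemma S_carrier_iff: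
  "x \<in> carrier S \<longleftrightarrow> x \<in> extensional (carrier G) \<and> (\<forall>g\<in>carrier G. x g \<in> D g) \<and> finite (supp x)"
  by (auto simp: crossed_product_def supp_def PiE_iff)

lemma finite_supp: "x \<in> carrier S \<Longrightarrow> finite (supp x)"
  by (simp add: S_carrier_iff)

lemma S_coeff_in_D: "\<lbrakk>x \<in> carrier S; g \<in> carrier G\<rbrakk> \<Longrightarrow> x g \<in> D g"
  by (simp add: S_carrier_iff)

lemma S_coeff_closed: "\<lbrakk>x \<in> carrier S; g \<in> carrier G\<rbrakk> \<Longrightarrow> x g \<in> carrier R"
  using S_coeff_in_D D_closed by blast

lemma S_eqI:
  "\<lbrakk>x \<in> carrier S; y \<in> carrier S; \<And>g. g \<in> carrier G \<Longrightarrow> x g = y g\<rbrakk> \<Longrightarrow> x = y"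
  by (rule extensionalityI[of _ "carrier G"]) (auto simp: S_carrier_iff)

lemma S_zero: "\<zero>\<^bsub>S\<^esub> = (\<lambda>g\<in>carrier G. \<zero>\<^bsub>R\<^esub>)"
  by (simp add: crossed_product_def)

lemma S_one: "\<one>\<^bsub>S\<^esub> = monomial \<one>\<^bsub>R\<^esub> \<one>\<^bsub>G\<^esub>"
  by (simp add: crossed_product_def monomial_def)

lemma S_add_coeff: "g \<in> carrier G \<Longrightarrow> (x \<oplus>\<^bsub>S\<^esub> y) g = x g \<oplus>\<^bsub>R\<^esub> y g"
  by (simp add: crossed_product_def)

lemma S_add_closed:
  assumes "x \<in> carrier S" "y \<in> carrier S"
  shows "x \<oplus>\<^bsub>S\<^esub> y \<in> carrier S"
proof -
  have "supp (x \<oplus>\<^bsub>S\<^esub> y) \<subseteq> supp x \<union> supp y"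
    by (auto simp: supp_def S_add_coeff)
  then have "finite (supp (x \<oplus>\<^bsub>S\<^esub> y))"
    using assms finite_supp finite_subset by blast
  moreover have "x \<oplus>\<^bsub>S\<^esub> y \<in> extensional (carrier G)"
    by (simp add: crossed_product_def)
  ultimately show ?thesis
    using assms by (simp add: S_carrier_iff S_add_coeff D_add)
qed

lemma S_abelian_group: "abelian_group S"
proof (rule abelian_groupI)
  show zero: "\<zero>\<^bsub>S\<^esub> \<in> carrier S"
    by (simp add: S_carrier_iff S_zero zero_in_D supp_def)
  fix x y assume x: "x \<in> carrier S" and y: "y \<in> carrier S"
  show "x \<oplus>\<^bsub>S\<^esub> y \<in> carrier S" by (rule S_add_closed[OF x y])
  show "x \<oplus>\<^bsub>S\<^esub> y = y \<oplus>\<^bsub>S\<^esub> x"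
    using x y by (intro S_eqI S_add_closed) (simp_all add: S_add_coeff R.a_comm S_coeff_closed)
  show "\<zero>\<^bsub>S\<^esub> \<oplus>\<^bsub>S\<^esub> x = x"
    using x zero by (intro S_eqI S_add_closed) (simp_all add: S_add_coeff S_coeff_closed S_zero)
  show "\<exists>y\<in>carrier S. y \<oplus>\<^bsub>S\<^esub> x = \<zero>\<^bsub>S\<^esub>"
  proof
    let ?n = "\<lambda>g\<in>carrier G. \<ominus>\<^bsub>R\<^esub> x g"
    have "supp ?n \<subseteq> supp x"
      by (auto simp: supp_def)
    then show n: "?n \<in> carrier S"
      using x finite_subset[OF _ finite_supp[OF x]]
      by (simp add: S_carrier_iff D_a_inv)
    show "?n \<oplus>\<^bsub>S\<^esub> x = \<zero>\<^bsub>S\<^esub>"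
      using x by (intro S_eqI S_add_closed n zero)
        (simp_all add: S_add_coeff S_coeff_closed S_zero R.l_neg)
  qed
  fix z assume z: "z \<in> carrier S"
  show "x \<oplus>\<^bsub>S\<^esub> y \<oplus>\<^bsub>S\<^esub> z = x \<oplus>\<^bsub>S\<^esub> (y \<oplus>\<^bsub>S\<^esub> z)"
    using x y z by (intro S_eqI S_add_closed) (simp_all add: S_add_coeff R.a_assoc S_coeff_closed)
qed

section \<open>Multiplication, supports of products and associativity\<close>

definition mult_term :: "('g \<Rightarrow> 'r) \<Rightarrow> ('g \<Rightarrow> 'r) \<Rightarrow> 'g \<Rightarrow> 'g \<Rightarrow> 'r" where
  "mult_term x y k g =
    x g \<otimes>\<^bsub>R\<^esub> T g (y (inv\<^bsub>G\<^esub> g \<otimes>\<^bsub>G\<^esub> k)) \<otimes>\<^bsub>R\<^esub> w g (inv\<^bsub>G\<^esub> g \<otimes>\<^bsub>G\<^esub> k)"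

lemma G_cancel:
  assumes "g \<in> carrier G" "k \<in> carrier G"
  shows "g \<otimes>\<^bsub>G\<^esub> (inv\<^bsub>G\<^esub> g \<otimes>\<^bsub>G\<^esub> k) = k" "inv\<^bsub>G\<^esub> g \<otimes>\<^bsub>G\<^esub> (g \<otimes>\<^bsub>G\<^esub> k) = k"
  using assms by (simp_all add: G.m_assoc[symmetric])

text \<open>The last factor \<open>w g (inv g k)\<close> already lies in \<open>D k\<close>.\<close>

lemma mult_term_in_D:
  assumes "x \<in> carrier S" "y \<in> carrier S" "k \<in> carrier G" "g \<in> carrier G"
  shows "mult_term x y k g \<in> D k"
  using assms w_in_D(2)[of g "inv\<^bsub>G\<^esub> g \<otimes>\<^bsub>G\<^esub> k"]
  by (simp add: mult_term_def G_cancel D_l_mult T_closed S_coeff_closed)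

lemma mult_term_closed:
  "\<lbrakk>x \<in> carrier S; y \<in> carrier S; k \<in> carrier G; g \<in> carrier G\<rbrakk> \<Longrightarrow> mult_term x y k g \<in> carrier R"
  using mult_term_in_D D_closed by blast

text \<open>The definition sums over the exact support of \<open>x\<close>. Since
  \<open>mult_term\<close> vanishes where \<open>x\<close> does, any finite larger index set
  \<open>A\<close> gives the same value, which permits a common range when several products are
  compared.\<close>

lemma S_mult_coeff:
  assumes x: "x \<in> carrier S" and y: "y \<in> carrier S" and k: "k \<in> carrier G"
    and A: "finite A" "supp x \<subseteq> A" "A \<subseteq> carrier G"
  shows "(x \<otimes>\<^bsub>S\<^esub> y) k = (\<Oplus>\<^bsub>R\<^esub>g\<in>A. mult_term x y k g)"
proof -
  have "(x \<otimes>\<^bsub>S\<^esub> y) k = (\<Oplus>\<^bsub>R\<^esub>g\<in>supp x.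
         \<alpha> g (inv_into (D (inv\<^bsub>G\<^esub> g)) (\<alpha> g) (x g) \<otimes>\<^bsub>R\<^esub> y (inv\<^bsub>G\<^esub> g \<otimes>\<^bsub>G\<^esub> k))
           \<otimes>\<^bsub>R\<^esub> w g (inv\<^bsub>G\<^esub> g \<otimes>\<^bsub>G\<^esub> k))"
    using k by (simp add: crossed_product_def supp_def)
  also have "\<dots> = (\<Oplus>\<^bsub>R\<^esub>g\<in>supp x. mult_term x y k g)"
  proof (rule R.finsum_cong'[OF refl])
    show "mult_term x y k \<in> supp x \<rightarrow> carrier R"
      using x y k supp_subset mult_term_closed by blast
  qed (use x y k supp_subset in
      \<open>auto simp: mult_term_def \<alpha>_inv_into_mult S_coeff_in_D S_coeff_closed subset_iff\<close>)
  also have "\<dots> = (\<Oplus>\<^bsub>R\<^esub>g\<in>A. mult_term x y k g)"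
  proof (rule R.add.finprod_mono_neutral_cong_left)
    fix g assume "g \<in> A - supp x"
    then have "g \<in> carrier G" "x g = \<zero>\<^bsub>R\<^esub>"
      using A by (auto simp: supp_def)
    then show "mult_term x y k g = \<zero>\<^bsub>R\<^esub>"
      using y k by (simp add: mult_term_def T_closed S_coeff_closed w_closed)
  qed (use A x y k mult_term_closed in auto)
  finally show ?thesis .
qed

lemma S_mult_coeff_supp:
  assumes "x \<in> carrier S" "y \<in> carrier S" "k \<in> carrier G"
  shows "(x \<otimes>\<^bsub>S\<^esub> y) k = (\<Oplus>\<^bsub>R\<^esub>g\<in>supp x. mult_term x y k g)"
  using assms by (intro S_mult_coeff finite_supp supp_subset) auto

text \<open>For \<open>g \<in> supp x\<close>, the partner index \<open>inv g k\<close> lies outside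
  \<open>supp y\<close> unless \<open>k\<close> is a product from the two supports. The bound serves
  closure and the range of the double sum in \<open>S_mult_assoc\<close>.\<close>

lemma S_mult_supp:
  assumes x: "x \<in> carrier S" and y: "y \<in> carrier S"
  shows "supp (x \<otimes>\<^bsub>S\<^esub> y) \<subseteq> (\<lambda>(g, h). g \<otimes>\<^bsub>G\<^esub> h) ` (supp x \<times> supp y)"
proof
  fix k assume k: "k \<in> supp (x \<otimes>\<^bsub>S\<^esub> y)"
  show "k \<in> (\<lambda>(g, h). g \<otimes>\<^bsub>G\<^esub> h) ` (supp x \<times> supp y)"
  proof (rule ccontr)
    assume *: "k \<notin> (\<lambda>(g, h). g \<otimes>\<^bsub>G\<^esub> h) ` (supp x \<times> supp y)"
    have kG: "k \<in> carrier G" using k supp_subset by blast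
    have "mult_term x y k g = \<zero>\<^bsub>R\<^esub>" if g: "g \<in> supp x" for g
    proof -
      have gG: "g \<in> carrier G" using g supp_subset by blast
      have "inv\<^bsub>G\<^esub> g \<otimes>\<^bsub>G\<^esub> k \<notin> supp y"
        using * g G_cancel(1)[OF gG kG] by force
      then have "y (inv\<^bsub>G\<^esub> g \<otimes>\<^bsub>G\<^esub> k) = \<zero>\<^bsub>R\<^esub>"
        using gG kG by (simp add: supp_def)
      then show ?thesis
        using gG kG x by (simp add: mult_term_def T_zero S_coeff_closed w_closed)
    qed
    then have "(x \<otimes>\<^bsub>S\<^esub> y) k = \<zero>\<^bsub>R\<^esub>"
      using S_mult_coeff_supp[OF x y kG] R.add.finprod_one_eqI by metis
    then show False using k by (simp add: supp_def)
  qed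
qed

lemma S_mult_closed:
  assumes x: "x \<in> carrier S" and y: "y \<in> carrier S"
  shows "x \<otimes>\<^bsub>S\<^esub> y \<in> carrier S"
proof -
  have "finite (supp (x \<otimes>\<^bsub>S\<^esub> y))"
    using finite_subset[OF S_mult_supp[OF x y]] finite_supp x y by blast
  moreover have "x \<otimes>\<^bsub>S\<^esub> y \<in> extensional (carrier G)"
    by (simp add: crossed_product_def)
  moreover have "(x \<otimes>\<^bsub>S\<^esub> y) k \<in> D k" if "k \<in> carrier G" for k
    using that x y supp_subset[of x]
    by (subst S_mult_coeff_supp) (auto intro!: ideal.finsum_in_ideal D_ideal mult_term_in_D finite_supp)
  ultimately show ?thesis by (simp add: S_carrier_iff)
qed

text \<open>Multiplicativity of \<open>T g\<close> exposes \<open>T g (w h t)\<close>,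
  \<open>T_cocycle\<close> turns it into \<open>w g h\<close> followed by \<open>w (g h) t\<close>,
  and \<open>T_twist\<close> moves \<open>w g h\<close> to the left of the factor containing
  \<open>c\<close>. This is associativity for three single terms.\<close>

lemma homogeneous_assoc:
  assumes "g \<in> carrier G" "h \<in> carrier G" "t \<in> carrier G"
    and "a \<in> carrier R" "b \<in> carrier R" "c \<in> carrier R"
  shows "a \<otimes>\<^bsub>R\<^esub> T g (b \<otimes>\<^bsub>R\<^esub> T h c \<otimes>\<^bsub>R\<^esub> w h t) \<otimes>\<^bsub>R\<^esub> w g (h \<otimes>\<^bsub>G\<^esub> t)
    = a \<otimes>\<^bsub>R\<^esub> T g b \<otimes>\<^bsub>R\<^esub> w g h \<otimes>\<^bsub>R\<^esub> T (g \<otimes>\<^bsub>G\<^esub> h) c \<otimes>\<^bsub>R\<^esub> w (g \<otimes>\<^bsub>G\<^esub> h) t"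
proof -
  note [simp] = assms T_closed w_closed
  have "a \<otimes>\<^bsub>R\<^esub> T g (b \<otimes>\<^bsub>R\<^esub> T h c \<otimes>\<^bsub>R\<^esub> w h t) \<otimes>\<^bsub>R\<^esub> w g (h \<otimes>\<^bsub>G\<^esub> t)
    = a \<otimes>\<^bsub>R\<^esub> T g b \<otimes>\<^bsub>R\<^esub> T g (T h c) \<otimes>\<^bsub>R\<^esub> (T g (w h t) \<otimes>\<^bsub>R\<^esub> w g (h \<otimes>\<^bsub>G\<^esub> t))"
    by (simp add: T_mult R.m_assoc)
  also have "\<dots> = a \<otimes>\<^bsub>R\<^esub> T g b \<otimes>\<^bsub>R\<^esub> (T g (T h c) \<otimes>\<^bsub>R\<^esub> w g h) \<otimes>\<^bsub>R\<^esub> w (g \<otimes>\<^bsub>G\<^esub> h) t"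
    by (simp add: T_cocycle R.m_assoc)
  finally show ?thesis
    by (simp add: T_twist R.m_assoc)
qed

lemma S_mult_assoc:
  assumes x: "x \<in> carrier S" and y: "y \<in> carrier S" and z: "z \<in> carrier S"
  shows "x \<otimes>\<^bsub>S\<^esub> y \<otimes>\<^bsub>S\<^esub> z = x \<otimes>\<^bsub>S\<^esub> (y \<otimes>\<^bsub>S\<^esub> z)"
proof (rule S_eqI)
  fix k assume k: "k \<in> carrier G"
  let ?A = "supp x" and ?C = "supp y"
  \<comment> \<open>Both sides become one double sum over \<open>g \<in> ?A\<close> and
    \<open>m \<in> ?B\<close>, where \<open>m\<close> stands for the product of \<open>g\<close>
    with an index of \<open>y\<close>.\<close>
  let ?B = "(\<lambda>(g, h). g \<otimes>\<^bsub>G\<^esub> h) ` (?A \<times> ?C)"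
  let ?z = "\<lambda>m. T m (z (inv\<^bsub>G\<^esub> m \<otimes>\<^bsub>G\<^esub> k)) \<otimes>\<^bsub>R\<^esub> w m (inv\<^bsub>G\<^esub> m \<otimes>\<^bsub>G\<^esub> k)"
  let ?F = "\<lambda>g m. mult_term x y m g \<otimes>\<^bsub>R\<^esub> ?z m"
  note [simp] = x y z S_coeff_closed T_closed w_closed mult_term_closed S_mult_closed finite_supp
  have A: "?A \<subseteq> carrier G" and C: "?C \<subseteq> carrier G" and B: "?B \<subseteq> carrier G" and finB: "finite ?B"
    by (auto simp: supp_def intro!: finite_imageI finite_cartesian_product)
      (simp_all add: supp_def[symmetric])
  have z_closed: "?z m \<in> carrier R" if "m \<in> carrier G" for m
    using that k by simp
  have F_closed: "?F g m \<in> carrier R" if "g \<in> carrier G" "m \<in> carrier G" for g m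
    using that k by simp
  have "(x \<otimes>\<^bsub>S\<^esub> y \<otimes>\<^bsub>S\<^esub> z) k = (\<Oplus>\<^bsub>R\<^esub>m\<in>?B. mult_term (x \<otimes>\<^bsub>S\<^esub> y) z k m)"
    using k B finB by (intro S_mult_coeff S_mult_supp) auto
  also have "\<dots> = (\<Oplus>\<^bsub>R\<^esub>m\<in>?B. \<Oplus>\<^bsub>R\<^esub>g\<in>?A. ?F g m)"
  proof (rule R.finsum_cong'[OF refl])
    fix m assume "m \<in> ?B"
    then have m: "m \<in> carrier G" using B by blast
    have "mult_term (x \<otimes>\<^bsub>S\<^esub> y) z k m = (x \<otimes>\<^bsub>S\<^esub> y) m \<otimes>\<^bsub>R\<^esub> ?z m"
      using k m by (simp add: mult_term_def R.m_assoc)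
    also have "\<dots> = (\<Oplus>\<^bsub>R\<^esub>g\<in>?A. mult_term x y m g) \<otimes>\<^bsub>R\<^esub> ?z m"
      using m by (simp add: S_mult_coeff_supp)
    also have "\<dots> = (\<Oplus>\<^bsub>R\<^esub>g\<in>?A. ?F g m)"
      using m A z_closed[OF m] by (intro R.finsum_ldistr) auto
    finally show "mult_term (x \<otimes>\<^bsub>S\<^esub> y) z k m = (\<Oplus>\<^bsub>R\<^esub>g\<in>?A. ?F g m)" .
  qed (use A B F_closed in \<open>blast intro: R.finsum_closed\<close>)
  also have "\<dots> = (\<Oplus>\<^bsub>R\<^esub>g\<in>?A. \<Oplus>\<^bsub>R\<^esub>m\<in>?B. ?F g m)"
    using A B F_closed finB by (intro R.finsum_swap) auto
  also have "\<dots> = (\<Oplus>\<^bsub>R\<^esub>g\<in>?A. mult_term x (y \<otimes>\<^bsub>S\<^esub> z) k g)"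
  proof (rule R.finsum_cong'[OF refl])
    show "mult_term x (y \<otimes>\<^bsub>S\<^esub> z) k \<in> ?A \<rightarrow> carrier R"
      using A k by auto
    fix g assume gA: "g \<in> ?A"
    then have g: "g \<in> carrier G" using A by blast
    let ?k = "inv\<^bsub>G\<^esub> g \<otimes>\<^bsub>G\<^esub> k"
    have "mult_term x (y \<otimes>\<^bsub>S\<^esub> z) k g
        = x g \<otimes>\<^bsub>R\<^esub> T g (\<Oplus>\<^bsub>R\<^esub>h\<in>?C. mult_term y z ?k h) \<otimes>\<^bsub>R\<^esub> w g ?k"
      using g k by (simp add: mult_term_def[of x] S_mult_coeff_supp)
    also have "\<dots> = x g \<otimes>\<^bsub>R\<^esub> (\<Oplus>\<^bsub>R\<^esub>h\<in>?C. T g (mult_term y z ?k h)) \<otimes>\<^bsub>R\<^esub> w g ?k"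
      using g k C by (subst T_finsum) auto
    also have "\<dots> = (\<Oplus>\<^bsub>R\<^esub>h\<in>?C. x g \<otimes>\<^bsub>R\<^esub> T g (mult_term y z ?k h)) \<otimes>\<^bsub>R\<^esub> w g ?k"
      using g k C by (subst R.finsum_rdistr) auto
    also have "\<dots> = (\<Oplus>\<^bsub>R\<^esub>h\<in>?C. x g \<otimes>\<^bsub>R\<^esub> T g (mult_term y z ?k h) \<otimes>\<^bsub>R\<^esub> w g ?k)"
      using g k C by (subst R.finsum_ldistr) auto
    \<comment> \<open>With \<open>m = g h\<close>, the index \<open>inv m k\<close> equals
      \<open>inv h (inv g k)\<close>, so \<open>homogeneous_assoc\<close> matches the summands;
      \<open>h\<close> is then reindexed to \<open>m\<close>.\<close>
    also have "\<dots> = (\<Oplus>\<^bsub>R\<^esub>h\<in>?C. ?F g (g \<otimes>\<^bsub>G\<^esub> h))"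
    proof (rule R.finsum_cong'[OF refl])
      show "(\<lambda>h. ?F g (g \<otimes>\<^bsub>G\<^esub> h)) \<in> ?C \<rightarrow> carrier R"
        using F_closed g C by blast
      fix h assume "h \<in> ?C"
      then have h: "h \<in> carrier G" using C by blast
      have "inv\<^bsub>G\<^esub> (g \<otimes>\<^bsub>G\<^esub> h) \<otimes>\<^bsub>G\<^esub> k = inv\<^bsub>G\<^esub> h \<otimes>\<^bsub>G\<^esub> ?k"
        using g h k by (simp add: G.inv_mult_group G.m_assoc)
      then show "x g \<otimes>\<^bsub>R\<^esub> T g (mult_term y z ?k h) \<otimes>\<^bsub>R\<^esub> w g ?k = ?F g (g \<otimes>\<^bsub>G\<^esub> h)"
        using homogeneous_assoc[of g h "inv\<^bsub>G\<^esub> h \<otimes>\<^bsub>G\<^esub> ?k" "x g" "y h" "z (inv\<^bsub>G\<^esub> h \<otimes>\<^bsub>G\<^esub> ?k)"] g h k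
        by (simp add: mult_term_def G_cancel R.m_assoc)
    qed
    also have "\<dots> = (\<Oplus>\<^bsub>R\<^esub>m\<in>(\<lambda>h. g \<otimes>\<^bsub>G\<^esub> h) ` ?C. ?F g m)"
      using g C F_closed by (intro R.finsum_reindex[symmetric]) (auto simp: inj_on_def subset_iff)
    \<comment> \<open>Enlarging the range to \<open>?B\<close> is harmless, since off the translate
      of \<open>supp y\<close> the coefficient \<open>y (inv g m)\<close> is zero.\<close>
    also have "\<dots> = (\<Oplus>\<^bsub>R\<^esub>m\<in>?B. ?F g m)"
    proof (rule R.add.finprod_mono_neutral_cong_left)
      fix m assume m: "m \<in> ?B - (\<lambda>h. g \<otimes>\<^bsub>G\<^esub> h) ` ?C"
      then have mG: "m \<in> carrier G" using B by blast
      have "inv\<^bsub>G\<^esub> g \<otimes>\<^bsub>G\<^esub> m \<notin> ?C"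
        using m G_cancel(1)[OF g mG] by force
      then have "y (inv\<^bsub>G\<^esub> g \<otimes>\<^bsub>G\<^esub> m) = \<zero>\<^bsub>R\<^esub>"
        using g mG by (simp add: supp_def)
      then show "?F g m = \<zero>\<^bsub>R\<^esub>"
        using g mG z_closed[OF mG] by (simp add: mult_term_def[of x] T_zero)
    qed (use finB gA F_closed[OF g] B in auto)
    finally show "(\<Oplus>\<^bsub>R\<^esub>m\<in>?B. ?F g m) = mult_term x (y \<otimes>\<^bsub>S\<^esub> z) k g" by simp
  qed
  also have "\<dots> = (x \<otimes>\<^bsub>S\<^esub> (y \<otimes>\<^bsub>S\<^esub> z)) k"
    using k by (simp add: S_mult_coeff_supp)
  finally show "(x \<otimes>\<^bsub>S\<^esub> y \<otimes>\<^bsub>S\<^esub> z) k = (x \<otimes>\<^bsub>S\<^esub> (y \<otimes>\<^bsub>S\<^esub> z)) k" .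
qed (use x y z S_mult_closed in auto)

section \<open>Monomials, the identity and the ring axioms\<close>

lemma monomial_coeff: "k \<in> carrier G \<Longrightarrow> monomial a g k = (if k = g then a else \<zero>\<^bsub>R\<^esub>)"
  by (simp add: monomial_def)

lemma supp_monomial: "supp (monomial a g) \<subseteq> {g}"
  by (auto simp: supp_def monomial_def)

lemma monomial_closed: "\<lbrakk>g \<in> carrier G; a \<in> D g\<rbrakk> \<Longrightarrow> monomial a g \<in> carrier S"
  using finite_subset[OF supp_monomial[of a g]]
  by (simp add: S_carrier_iff) (simp add: monomial_def zero_in_D)

lemma monomial_mult_coeff:
  assumes g: "g \<in> carrier G" and a: "a \<in> D g" and y: "y \<in> carrier S" and k: "k \<in> carrier G"
  shows "(monomial a g \<otimes>\<^bsub>S\<^esub> y) k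
    = a \<otimes>\<^bsub>R\<^esub> T g (y (inv\<^bsub>G\<^esub> g \<otimes>\<^bsub>G\<^esub> k)) \<otimes>\<^bsub>R\<^esub> w g (inv\<^bsub>G\<^esub> g \<otimes>\<^bsub>G\<^esub> k)"
proof -
  have "(monomial a g \<otimes>\<^bsub>S\<^esub> y) k = (\<Oplus>\<^bsub>R\<^esub>h\<in>{g}. mult_term (monomial a g) y k h)"
    using assms by (intro S_mult_coeff monomial_closed supp_monomial) auto
  also have "\<dots> = mult_term (monomial a g) y k g"
    using assms mult_term_closed[OF monomial_closed[OF g a] y k g] by simp
  finally show ?thesis
    using g by (simp add: mult_term_def monomial_coeff)
qed

lemma mult_monomial_coeff:
  assumes x: "x \<in> carrier S" and h: "h \<in> carrier G" and b: "b \<in> D h" and k: "k \<in> carrier G"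
  shows "(x \<otimes>\<^bsub>S\<^esub> monomial b h) k
    = x (k \<otimes>\<^bsub>G\<^esub> inv\<^bsub>G\<^esub> h) \<otimes>\<^bsub>R\<^esub> T (k \<otimes>\<^bsub>G\<^esub> inv\<^bsub>G\<^esub> h) b \<otimes>\<^bsub>R\<^esub> w (k \<otimes>\<^bsub>G\<^esub> inv\<^bsub>G\<^esub> h) h"
proof -
  let ?g = "k \<otimes>\<^bsub>G\<^esub> inv\<^bsub>G\<^esub> h" and ?b = "monomial b h"
  have g: "?g \<in> carrier G" using h k by simp
  have b': "?b \<in> carrier S" using h b by (rule monomial_closed)
  \<comment> \<open>The index \<open>?g\<close> is the solution of \<open>inv g k = h\<close>, so no
    other summand can be nonzero; it is inserted by hand because \<open>x ?g\<close> may be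
    zero.\<close>
  have "(x \<otimes>\<^bsub>S\<^esub> ?b) k = (\<Oplus>\<^bsub>R\<^esub>g\<in>insert ?g (supp x). mult_term x ?b k g)"
    using x g k finite_supp[OF x] supp_subset by (intro S_mult_coeff b') auto
  also have "\<dots> = (\<Oplus>\<^bsub>R\<^esub>g\<in>{?g}. mult_term x ?b k g)"
  proof (rule R.add.finprod_mono_neutral_cong_right)
    fix g' assume g': "g' \<in> insert ?g (supp x) - {?g}"
    then have g'G: "g' \<in> carrier G" using supp_subset by blast
    have "inv\<^bsub>G\<^esub> g' \<otimes>\<^bsub>G\<^esub> k \<noteq> h"
      using g' g'G h k G_cancel(1)[OF g'G k] by (metis Diff_iff G.inv_solve_right insertCI)
    then show "mult_term x ?b k g' = \<zero>\<^bsub>R\<^esub>"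
      using g'G k x by (simp add: mult_term_def monomial_coeff T_zero S_coeff_closed w_closed)
  qed (use g x k b' finite_supp[OF x] supp_subset[of x] mult_term_closed in auto)
  also have "\<dots> = mult_term x ?b k ?g"
    using mult_term_closed[OF x b' k g] by simp
  also have "inv\<^bsub>G\<^esub> ?g \<otimes>\<^bsub>G\<^esub> k = h"
    using h k by (simp add: G.inv_mult_group G.m_assoc)
  then have "mult_term x ?b k ?g = x ?g \<otimes>\<^bsub>R\<^esub> T ?g b \<otimes>\<^bsub>R\<^esub> w ?g h"
    using h by (simp add: mult_term_def monomial_coeff)
  finally show ?thesis .
qed

lemma one_mult_coeff:
  assumes r: "r \<in> carrier R" and y: "y \<in> carrier S" and k: "k \<in> carrier G"
  shows "(monomial r \<one>\<^bsub>G\<^esub> \<otimes>\<^bsub>S\<^esub> y) k = r \<otimes>\<^bsub>R\<^esub> y k"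
  using assms
  by (simp add: monomial_mult_coeff D_one T_id S_coeff_closed w_one_left u_closed D_l_mult D_mult_u
      S_coeff_in_D)

text \<open>With \<open>one_mult_coeff\<close> this gives the coefficients of commutators with
  \<open>R\<close>. The twist \<open>w k \<one>\<close> is \<open>u k\<close>, which
  \<open>T k r\<close> absorbs.\<close>

lemma mult_one_coeff:
  assumes x: "x \<in> carrier S" and r: "r \<in> carrier R" and k: "k \<in> carrier G"
  shows "(x \<otimes>\<^bsub>S\<^esub> monomial r \<one>\<^bsub>G\<^esub>) k = x k \<otimes>\<^bsub>R\<^esub> T k r"
  using assms
  by (simp add: mult_monomial_coeff D_one w_one_right R.m_assoc D_mult_u T_in_D S_coeff_closed T_closed u_closed)

lemma S_ring: "ring S"
proof (rule ringI)
  show "abelian_group S" by (rule S_abelian_group)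
  have one: "\<one>\<^bsub>S\<^esub> \<in> carrier S"
    by (simp add: S_one monomial_closed D_one)
  show "monoid S"
  proof (rule monoidI)
    fix x assume x: "x \<in> carrier S"
    show "\<one>\<^bsub>S\<^esub> \<otimes>\<^bsub>S\<^esub> x = x"
      using x one by (intro S_eqI S_mult_closed) (simp_all add: S_one one_mult_coeff S_coeff_closed)
    show "x \<otimes>\<^bsub>S\<^esub> \<one>\<^bsub>S\<^esub> = x"
      using x one by (intro S_eqI S_mult_closed)
        (simp_all add: S_one mult_one_coeff T_one D_mult_u S_coeff_in_D)
  qed (use one S_mult_closed S_mult_assoc in auto)
  fix x y z assume x: "x \<in> carrier S" and y: "y \<in> carrier S" and z: "z \<in> carrier S"
  note closed = x y z S_add_closed S_mult_closed S_coeff_closed T_closed w_closed mult_term_closed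
  show "(x \<oplus>\<^bsub>S\<^esub> y) \<otimes>\<^bsub>S\<^esub> z = x \<otimes>\<^bsub>S\<^esub> z \<oplus>\<^bsub>S\<^esub> y \<otimes>\<^bsub>S\<^esub> z"
  proof (rule S_eqI)
    fix k assume k: "k \<in> carrier G"
    \<comment> \<open>The support of the sum can shrink by cancellation, so all three products are
      expanded over the union of the supports.\<close>
    let ?A = "supp x \<union> supp y"
    have A: "finite ?A" "?A \<subseteq> carrier G" "supp (x \<oplus>\<^bsub>S\<^esub> y) \<subseteq> ?A"
      using x y finite_supp by (auto simp: supp_def S_add_coeff)
    have "((x \<oplus>\<^bsub>S\<^esub> y) \<otimes>\<^bsub>S\<^esub> z) k = (\<Oplus>\<^bsub>R\<^esub>g\<in>?A. mult_term (x \<oplus>\<^bsub>S\<^esub> y) z k g)"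
      using k A by (intro S_mult_coeff) (simp_all add: closed)
    also have "\<dots> = (\<Oplus>\<^bsub>R\<^esub>g\<in>?A. mult_term x z k g \<oplus>\<^bsub>R\<^esub> mult_term y z k g)"
      using k A by (intro R.finsum_cong')
        (auto simp: closed mult_term_def S_add_coeff R.l_distr subset_iff)
    also have "\<dots> = (\<Oplus>\<^bsub>R\<^esub>g\<in>?A. mult_term x z k g) \<oplus>\<^bsub>R\<^esub> (\<Oplus>\<^bsub>R\<^esub>g\<in>?A. mult_term y z k g)"
      using k A by (intro R.finsum_addf) (auto simp: closed)
    also have "(\<Oplus>\<^bsub>R\<^esub>g\<in>?A. mult_term x z k g) = (x \<otimes>\<^bsub>S\<^esub> z) k"
      using k A by (intro S_mult_coeff[symmetric]) (simp_all add: closed)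
    also have "(\<Oplus>\<^bsub>R\<^esub>g\<in>?A. mult_term y z k g) = (y \<otimes>\<^bsub>S\<^esub> z) k"
      using k A by (intro S_mult_coeff[symmetric]) (simp_all add: closed)
    finally show "((x \<oplus>\<^bsub>S\<^esub> y) \<otimes>\<^bsub>S\<^esub> z) k = (x \<otimes>\<^bsub>S\<^esub> z \<oplus>\<^bsub>S\<^esub> y \<otimes>\<^bsub>S\<^esub> z) k"
      using k by (simp add: S_add_coeff)
  qed (simp_all add: closed)
  show "z \<otimes>\<^bsub>S\<^esub> (x \<oplus>\<^bsub>S\<^esub> y) = z \<otimes>\<^bsub>S\<^esub> x \<oplus>\<^bsub>S\<^esub> z \<otimes>\<^bsub>S\<^esub> y"
  proof (rule S_eqI)
    fix k assume k: "k \<in> carrier G"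
    have "(z \<otimes>\<^bsub>S\<^esub> (x \<oplus>\<^bsub>S\<^esub> y)) k = (\<Oplus>\<^bsub>R\<^esub>g\<in>supp z. mult_term z (x \<oplus>\<^bsub>S\<^esub> y) k g)"
      using k by (intro S_mult_coeff_supp) (simp_all add: closed)
    also have "\<dots> = (\<Oplus>\<^bsub>R\<^esub>g\<in>supp z. mult_term z x k g \<oplus>\<^bsub>R\<^esub> mult_term z y k g)"
      using k supp_subset[of z] by (intro R.finsum_cong')
        (auto simp: closed mult_term_def S_add_coeff T_add R.l_distr R.r_distr subset_iff)
    also have "\<dots> = (\<Oplus>\<^bsub>R\<^esub>g\<in>supp z. mult_term z x k g) \<oplus>\<^bsub>R\<^esub> (\<Oplus>\<^bsub>R\<^esub>g\<in>supp z. mult_term z y k g)"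
      using k supp_subset[of z] by (intro R.finsum_addf) (auto simp: closed)
    finally show "(z \<otimes>\<^bsub>S\<^esub> (x \<oplus>\<^bsub>S\<^esub> y)) k = (z \<otimes>\<^bsub>S\<^esub> x \<oplus>\<^bsub>S\<^esub> z \<otimes>\<^bsub>S\<^esub> y) k"
      using k by (simp add: S_add_coeff S_mult_coeff_supp closed)
  qed (simp_all add: closed)
qed

subsection \<open>Ideals of the crossed product\<close>

text \<open>The negative in \<open>S\<close> is given only through the group structure, so
  uniqueness of negatives in \<open>R\<close> is applied at each coefficient.\<close>

lemma S_a_inv_coeff:
  assumes x: "x \<in> carrier S" and g: "g \<in> carrier G"
  shows "(\<ominus>\<^bsub>S\<^esub> x) g = \<ominus>\<^bsub>R\<^esub> x g"
proof -
  interpret S: ring S by (rule S_ring)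
  have "(\<ominus>\<^bsub>S\<^esub> x \<oplus>\<^bsub>S\<^esub> x) g = \<zero>\<^bsub>R\<^esub>"
    using x g by (simp add: S.l_neg S_zero)
  then show ?thesis
    using x g by (simp add: S_add_coeff R.minus_equality S_coeff_closed)
qed

lemma monomial_add:
  "\<lbrakk>a \<in> carrier R; b \<in> carrier R\<rbrakk>
    \<Longrightarrow> monomial (a \<oplus>\<^bsub>R\<^esub> b) g = monomial a g \<oplus>\<^bsub>S\<^esub> monomial b g"
  by (rule extensionalityI[of _ "carrier G"])
    (auto simp: S_add_coeff monomial_coeff monomial_def[of "a \<oplus>\<^bsub>R\<^esub> b"] crossed_product_def)

lemma monomial_mult_monomial:
  assumes g: "g \<in> carrier G" and h: "h \<in> carrier G" and a: "a \<in> D g" and b: "b \<in> D h"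
  shows "monomial a g \<otimes>\<^bsub>S\<^esub> monomial b h
    = monomial (a \<otimes>\<^bsub>R\<^esub> T g b \<otimes>\<^bsub>R\<^esub> w g h) (g \<otimes>\<^bsub>G\<^esub> h)"
proof (rule S_eqI)
  have closed: "a \<in> carrier R" "b \<in> carrier R"
    using assms D_closed by blast+
  show "monomial a g \<otimes>\<^bsub>S\<^esub> monomial b h \<in> carrier S"
    using assms by (intro S_mult_closed monomial_closed)
  show "monomial (a \<otimes>\<^bsub>R\<^esub> T g b \<otimes>\<^bsub>R\<^esub> w g h) (g \<otimes>\<^bsub>G\<^esub> h) \<in> carrier S"
    using g h closed by (intro monomial_closed D_l_mult w_in_D) (auto simp: T_closed)
  fix k assume k: "k \<in> carrier G"
  have "inv\<^bsub>G\<^esub> g \<otimes>\<^bsub>G\<^esub> k = h \<longleftrightarrow> k = g \<otimes>\<^bsub>G\<^esub> h"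
    using g h k by (metis G_cancel)
  then show "(monomial a g \<otimes>\<^bsub>S\<^esub> monomial b h) k
      = monomial (a \<otimes>\<^bsub>R\<^esub> T g b \<otimes>\<^bsub>R\<^esub> w g h) (g \<otimes>\<^bsub>G\<^esub> h) k"
    using assms k closed
    by (auto simp: monomial_mult_coeff monomial_closed monomial_coeff T_zero w_closed)
qed

section \<open>Passing between ideals of \<open>R\<close> and ideals of \<open>S\<close>\<close>

lemma base_ring_copy_eq: "base_ring_copy G R = (\<lambda>r. monomial r \<one>\<^bsub>G\<^esub>) ` carrier R"
  by (simp add: base_ring_copy_def monomial_def)

lemma base_closed: "r \<in> carrier R \<Longrightarrow> monomial r \<one>\<^bsub>G\<^esub> \<in> carrier S"
  by (simp add: monomial_closed D_one)

lemma base_mult: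
  "\<lbrakk>r \<in> carrier R; s \<in> carrier R\<rbrakk>
    \<Longrightarrow> monomial r \<one>\<^bsub>G\<^esub> \<otimes>\<^bsub>S\<^esub> monomial s \<one>\<^bsub>G\<^esub> = monomial (r \<otimes>\<^bsub>R\<^esub> s) \<one>\<^bsub>G\<^esub>"
  by (simp add: monomial_mult_monomial D_one T_id w_one_right u_one)

text \<open>Invariance makes \<open>T g\<close> map \<open>I\<close> into itself, as multiplying by
  \<open>u (inv g)\<close> stays in \<open>I\<close> and lands in \<open>D (inv g)\<close>. Hence
  each \<open>mult_term\<close> lies in \<open>I\<close> as soon as one of the two factors has its
  coefficients there.\<close>

lemma invariant_ideal_extension:
  assumes I: "invariant_ideal G R D \<alpha> I"
  shows "ideal {x \<in> carrier S. \<forall>g\<in>carrier G. x g \<in> I} S"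
proof -
  interpret S: ring S by (rule S_ring)
  interpret I: ideal I R using I by (simp add: invariant_ideal_def)
  have T_I: "T g r \<in> I" if "g \<in> carrier G" "r \<in> I" for g r
  proof -
    have "u (inv\<^bsub>G\<^esub> g) \<otimes>\<^bsub>R\<^esub> r \<in> I \<inter> D (inv\<^bsub>G\<^esub> g)"
      using that by (simp add: I.I_l_closed I.Icarr u_closed u_mult_in_D)
    then show ?thesis
      using I that(1) by (auto simp: invariant_ideal_def T_def)
  qed
  show ?thesis
  proof (rule idealI)
    show "ring S" by (rule S_ring)
    show "subgroup {x \<in> carrier S. \<forall>g\<in>carrier G. x g \<in> I} (add_monoid S)"
    proof (rule S.add.subgroupI)
      show "{x \<in> carrier S. \<forall>g\<in>carrier G. x g \<in> I} \<noteq> {}"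
        using S.zero_closed by (auto simp: S_zero)
    qed (auto simp: S_add_coeff S_a_inv_coeff I.a_closed I.a_inv_closed S_add_closed)
  next
    fix x y assume x: "x \<in> {x \<in> carrier S. \<forall>g\<in>carrier G. x g \<in> I}" and y: "y \<in> carrier S"
    have "mult_term y x k g \<in> I" "mult_term x y k g \<in> I"
      if "k \<in> carrier G" "g \<in> carrier G" for k g
      unfolding mult_term_def using x y that
      by (simp_all add: I.I_l_closed I.I_r_closed T_I T_closed w_closed S_coeff_closed)
    then show "y \<otimes>\<^bsub>S\<^esub> x \<in> {x \<in> carrier S. \<forall>g\<in>carrier G. x g \<in> I}"
      "x \<otimes>\<^bsub>S\<^esub> y \<in> {x \<in> carrier S. \<forall>g\<in>carrier G. x g \<in> I}"
      using x y supp_subset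
      by (auto simp: S_mult_closed S_mult_coeff_supp finite_supp subset_iff
          intro!: I.finsum_in_ideal)
  qed
qed

text \<open>An invariant \<open>I\<close> is recovered from its extension \<open>?J\<close> at the
  identity coefficient: a zero \<open>?J\<close> kills every \<open>monomial r \<one>\<close> with
  \<open>r \<in> I\<close>, and a full one puts the identity of \<open>R\<close> into
  \<open>I\<close>.\<close>

lemma action_simple_if_simple:
  assumes simple: "simple_ring S"
  shows "action_simple G R D \<alpha>"
  unfolding action_simple_def
proof (intro allI impI)
  fix I assume inv: "invariant_ideal G R D \<alpha> I"
  interpret I: ideal I R using inv by (simp add: invariant_ideal_def)
  let ?J = "{x \<in> carrier S. \<forall>g\<in>carrier G. x g \<in> I}"
  have base: "monomial r \<one>\<^bsub>G\<^esub> \<in> ?J" if "r \<in> I" for r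
    using that by (auto simp: base_closed I.Icarr monomial_coeff)
  from simple invariant_ideal_extension[OF inv] consider "?J = {\<zero>\<^bsub>S\<^esub>}" | "?J = carrier S"
    by (auto simp: simple_ring_def)
  then show "I = {\<zero>\<^bsub>R\<^esub>} \<or> I = carrier R"
  proof cases
    case 1
    have "r = \<zero>\<^bsub>R\<^esub>" if "r \<in> I" for r
    proof -
      have "monomial r \<one>\<^bsub>G\<^esub> = \<zero>\<^bsub>S\<^esub>" using base[OF that] 1 by blast
      then show ?thesis by (metis G.one_closed S_zero monomial_coeff restrict_apply')
    qed
    then show ?thesis using I.zero_closed by blast
  next
    case 2
    then have "monomial \<one>\<^bsub>R\<^esub> \<one>\<^bsub>G\<^esub> \<in> ?J" using base_closed by simp
    then have "monomial \<one>\<^bsub>R\<^esub> \<one>\<^bsub>G\<^esub> \<one>\<^bsub>G\<^esub> \<in> I" by blast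
    then have "\<one>\<^bsub>R\<^esub> \<in> I" by (simp add: monomial_coeff)
    then show ?thesis using I.one_imp_carrier by blast
  qed
qed

text \<open>For invariance, \<open>a\<close> is multiplied by the monomial of \<open>u g\<close> at
  \<open>g\<close> on the left and by that of \<open>u (inv g)\<close> at \<open>inv g\<close> on
  the right. This gives \<open>T g a \<otimes> w g (inv g)\<close> at the identity, and
  invertibility of the twist removes the second factor.\<close>

lemma ideal_restriction_invariant:
  assumes J: "ideal J S"
  shows "invariant_ideal G R D \<alpha> {r \<in> carrier R. monomial r \<one>\<^bsub>G\<^esub> \<in> J}"
    (is "invariant_ideal G R D \<alpha> ?I")
proof -
  interpret S: ring S by (rule S_ring)
  interpret J: ideal J S by (rule J)
  have mult: "monomial (r \<otimes>\<^bsub>R\<^esub> s) \<one>\<^bsub>G\<^esub> \<in> J" "monomial (s \<otimes>\<^bsub>R\<^esub> r) \<one>\<^bsub>G\<^esub> \<in> J"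
    if "r \<in> ?I" "s \<in> carrier R" for r s
    using that by (auto simp: base_mult[symmetric] base_closed J.I_l_closed J.I_r_closed)
  have "ideal ?I R"
  proof (rule idealI)
    show "ring R" by (rule R.ring_axioms)
    show "subgroup ?I (add_monoid R)"
    proof (rule R.add.subgroupI)
      have "monomial \<zero>\<^bsub>R\<^esub> \<one>\<^bsub>G\<^esub> = \<zero>\<^bsub>S\<^esub>"
        by (auto simp: S_zero monomial_def)
      then show "?I \<noteq> {}" using J.zero_closed by force
      fix r assume r: "r \<in> ?I"
      then show "\<ominus>\<^bsub>R\<^esub> r \<in> ?I"
        using mult(1)[OF r, of "\<ominus>\<^bsub>R\<^esub> \<one>\<^bsub>R\<^esub>"] by (simp add: R.r_minus)
    qed (auto simp: monomial_add J.a_closed)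
  qed (use mult in auto)
  moreover have "\<alpha> g a \<in> ?I" if g: "g \<in> carrier G" and a: "a \<in> ?I" "a \<in> D (inv\<^bsub>G\<^esub> g)" for g a
  proof -
    have aR: "a \<in> carrier R" and aJ: "monomial a \<one>\<^bsub>G\<^esub> \<in> J" using a(1) by auto
    have Ta: "T g a \<in> D g" "T g a \<in> carrier R" using g aR T_in_D T_closed by auto
    have "monomial (u g) g \<otimes>\<^bsub>S\<^esub> monomial a \<one>\<^bsub>G\<^esub> = monomial (T g a) g"
      using g aR Ta
      by (simp add: monomial_mult_monomial u_in_D D_one w_one_right D_u_mult D_mult_u)
    then have 1: "monomial (T g a) g \<in> J"
      using J.I_l_closed[OF aJ, of "monomial (u g) g"] g by (simp add: monomial_closed u_in_D)
    have "monomial (T g a) g \<otimes>\<^bsub>S\<^esub> monomial (u (inv\<^bsub>G\<^esub> g)) (inv\<^bsub>G\<^esub> g)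
        = monomial (T g a \<otimes>\<^bsub>R\<^esub> w g (inv\<^bsub>G\<^esub> g)) \<one>\<^bsub>G\<^esub>"
      using g Ta by (simp add: monomial_mult_monomial u_in_D T_u u_one u_closed D_mult_u)
    then have 2: "T g a \<otimes>\<^bsub>R\<^esub> w g (inv\<^bsub>G\<^esub> g) \<in> ?I"
      using J.I_r_closed[OF 1, of "monomial (u (inv\<^bsub>G\<^esub> g)) (inv\<^bsub>G\<^esub> g)"] g Ta
      by (simp add: monomial_closed u_in_D w_closed)
    \<comment> \<open>The product of \<open>w g (inv g)\<close> and its inverse is
      \<open>u g \<otimes> u \<one>\<close>, which is \<open>u g\<close> and therefore fixes
      \<open>T g a\<close>.\<close>
    have "T g a \<otimes>\<^bsub>R\<^esub> w g (inv\<^bsub>G\<^esub> g) \<otimes>\<^bsub>R\<^esub> w_inv g (inv\<^bsub>G\<^esub> g) = T g a"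
      using w_inv_r[of g "inv\<^bsub>G\<^esub> g"] w_inv_closed[of g "inv\<^bsub>G\<^esub> g"] g Ta
      by (simp add: R.m_assoc w_closed u_one u_closed D_mult_u)
    then show ?thesis
      using mult(1)[OF 2, of "w_inv g (inv\<^bsub>G\<^esub> g)"] w_inv_closed[of g "inv\<^bsub>G\<^esub> g"] g a Ta
      by (simp add: T_on_D)
  qed
  ultimately show ?thesis
    by (auto simp: invariant_ideal_def \<alpha>_closed)
qed

section \<open>Nonzero ideals and minimal supports\<close>

lemma supp_eq_empty_iff: "x \<in> carrier S \<Longrightarrow> supp x = {} \<longleftrightarrow> x = \<zero>\<^bsub>S\<^esub>"
  using ring.ring_simprules(2)[OF S_ring] by (auto simp: supp_def S_zero intro!: S_eqI)

text \<open>
  A nonzero \<open>x \<in> J\<close> of minimal support, translated so that the coefficient at the identity is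
  nonzero, commutes with \<open>R\<close>: its commutator with an element of \<open>R\<close> lies in \<open>J\<close> and has smaller
  support, as \<open>R\<close> is commutative.
\<close>

lemma maximal_commutative_ideal_meets_base:
  assumes max: "maximal_commutative (base_ring_copy G R) S"
    and J: "ideal J S" and nonzero: "J \<noteq> {\<zero>\<^bsub>S\<^esub>}"
  obtains r where "r \<in> carrier R" "r \<noteq> \<zero>\<^bsub>R\<^esub>" "monomial r \<one>\<^bsub>G\<^esub> \<in> J"
proof -
  interpret S: ring S by (rule S_ring)
  interpret J: ideal J S by (rule J)
  have base: "centralizer S (base_ring_copy G R) = base_ring_copy G R"
    using max by (simp only: maximal_commutative_def)
  \<comment> \<open>The base copy equals its own centralizer, so its elements commute with one
    another.\<close>
  have comm: "r \<otimes>\<^bsub>R\<^esub> s = s \<otimes>\<^bsub>R\<^esub> r" if "r \<in> carrier R" "s \<in> carrier R" for r s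
  proof -
    have "monomial r \<one>\<^bsub>G\<^esub> \<in> centralizer S (base_ring_copy G R)"
      unfolding base using that by (simp add: base_ring_copy_eq)
    then have "monomial (r \<otimes>\<^bsub>R\<^esub> s) \<one>\<^bsub>G\<^esub> = monomial (s \<otimes>\<^bsub>R\<^esub> r) \<one>\<^bsub>G\<^esub>"
      using that by (simp add: centralizer_def base_ring_copy_eq base_mult)
    then show ?thesis
      by (metis G.one_closed monomial_coeff)
  qed
  obtain x0 where "x0 \<in> J \<and> x0 \<noteq> \<zero>\<^bsub>S\<^esub>" using nonzero J.zero_closed by blast
  from ex_has_least_nat[of "\<lambda>x. x \<in> J \<and> x \<noteq> \<zero>\<^bsub>S\<^esub>", OF this, of "\<lambda>x. card (supp x)"]
  obtain x where x: "x \<in> J" "x \<noteq> \<zero>\<^bsub>S\<^esub>"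
    and min: "\<forall>y. y \<in> J \<and> y \<noteq> \<zero>\<^bsub>S\<^esub> \<longrightarrow> card (supp x) \<le> card (supp y)"
    by (elim exE conjE)
  have xS: "x \<in> carrier S" using x by (simp add: J.Icarr)
  obtain g where gx: "g \<in> supp x" using x xS supp_eq_empty_iff by blast
  then have g: "g \<in> carrier G" and xg: "x g \<noteq> \<zero>\<^bsub>R\<^esub>" by (auto simp: supp_def)
  \<comment> \<open>Right multiplication by this monomial carries the index \<open>g\<close> to the
    identity.\<close>
  define y where "y = x \<otimes>\<^bsub>S\<^esub> monomial (u (inv\<^bsub>G\<^esub> g)) (inv\<^bsub>G\<^esub> g)"
  have yJ: "y \<in> J"
    unfolding y_def using x g by (intro J.I_r_closed monomial_closed u_in_D) auto
  then have yS: "y \<in> carrier S" by (rule J.Icarr)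
  have y_coeff: "y k = x (k \<otimes>\<^bsub>G\<^esub> g) \<otimes>\<^bsub>R\<^esub> T (k \<otimes>\<^bsub>G\<^esub> g) (u (inv\<^bsub>G\<^esub> g))
      \<otimes>\<^bsub>R\<^esub> w (k \<otimes>\<^bsub>G\<^esub> g) (inv\<^bsub>G\<^esub> g)" if "k \<in> carrier G" for k
    using that xS g by (simp add: y_def mult_monomial_coeff u_in_D)
  \<comment> \<open>The coefficient here is \<open>x g \<otimes> w g (inv g)\<close>; cancelling the
    twist against its inverse leaves \<open>x g \<otimes> u g\<close>, which is
    \<open>x g\<close>.\<close>
  have y1: "y \<one>\<^bsub>G\<^esub> \<noteq> \<zero>\<^bsub>R\<^esub>"
  proof
    assume "y \<one>\<^bsub>G\<^esub> = \<zero>\<^bsub>R\<^esub>"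
    then have "x g \<otimes>\<^bsub>R\<^esub> w g (inv\<^bsub>G\<^esub> g) = \<zero>\<^bsub>R\<^esub>"
      using g xS by (simp add: y_coeff T_u u_one u_closed D_mult_u S_coeff_in_D)
    then have "x g \<otimes>\<^bsub>R\<^esub> (w g (inv\<^bsub>G\<^esub> g) \<otimes>\<^bsub>R\<^esub> w_inv g (inv\<^bsub>G\<^esub> g)) = \<zero>\<^bsub>R\<^esub>"
      using g xS w_inv_closed[of g "inv\<^bsub>G\<^esub> g"]
      by (simp add: R.m_assoc[symmetric] S_coeff_closed w_closed)
    then show False
      using g xS xg w_inv_r[of g "inv\<^bsub>G\<^esub> g"]
      by (simp add: u_one u_closed D_mult_u S_coeff_in_D)
  qed
  \<comment> \<open>Translation may annihilate coefficients but creates none, so \<open>y\<close>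
    has at most as many as \<open>x\<close>, and the minimality of \<open>x\<close> passes to
    it.\<close>
  have "supp y \<subseteq> (\<lambda>k. k \<otimes>\<^bsub>G\<^esub> inv\<^bsub>G\<^esub> g) ` supp x"
  proof
    fix k assume k: "k \<in> supp y"
    then have kG: "k \<in> carrier G" by (simp add: supp_def)
    have "x (k \<otimes>\<^bsub>G\<^esub> g) \<noteq> \<zero>\<^bsub>R\<^esub>"
    proof
      assume "x (k \<otimes>\<^bsub>G\<^esub> g) = \<zero>\<^bsub>R\<^esub>"
      then have "y k = \<zero>\<^bsub>R\<^esub>"
        using kG g by (simp add: y_coeff T_closed u_closed w_closed)
      then show False using k by (simp add: supp_def)
    qed
    then have "k \<otimes>\<^bsub>G\<^esub> g \<in> supp x" using kG g by (simp add: supp_def)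
    moreover have "k = k \<otimes>\<^bsub>G\<^esub> g \<otimes>\<^bsub>G\<^esub> inv\<^bsub>G\<^esub> g" using kG g by (simp add: G.m_assoc)
    ultimately show "k \<in> (\<lambda>k. k \<otimes>\<^bsub>G\<^esub> inv\<^bsub>G\<^esub> g) ` supp x" by blast
  qed
  then have card_y: "card (supp y) \<le> card (supp x)"
    using finite_supp[OF xS] by (rule surj_card_le[rotated])
  have "y \<otimes>\<^bsub>S\<^esub> monomial r \<one>\<^bsub>G\<^esub> = monomial r \<one>\<^bsub>G\<^esub> \<otimes>\<^bsub>S\<^esub> y" if r: "r \<in> carrier R" for r
  proof (rule ccontr)
    let ?yr = "y \<otimes>\<^bsub>S\<^esub> monomial r \<one>\<^bsub>G\<^esub>" and ?ry = "monomial r \<one>\<^bsub>G\<^esub> \<otimes>\<^bsub>S\<^esub> y"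
    let ?z = "?yr \<oplus>\<^bsub>S\<^esub> \<ominus>\<^bsub>S\<^esub> ?ry"
    assume neq: "?yr \<noteq> ?ry"
    have closed: "?yr \<in> carrier S" "?ry \<in> carrier S"
      using yS base_closed[OF r] by simp_all
    have zJ: "?z \<in> J"
      using yJ base_closed[OF r]
      by (intro J.a_closed J.a_inv_closed J.I_l_closed J.I_r_closed)
    have "?z \<noteq> \<zero>\<^bsub>S\<^esub>"
    proof
      assume "?z = \<zero>\<^bsub>S\<^esub>"
      then have "?yr = \<ominus>\<^bsub>S\<^esub> (\<ominus>\<^bsub>S\<^esub> ?ry)"
        using closed by (intro S.minus_equality[symmetric] S.a_inv_closed)
      with neq closed show False by (simp add: S.minus_minus)
    qed
    with min zJ have "card (supp x) \<le> card (supp ?z)" by blast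
    with card_y have le: "card (supp y) \<le> card (supp ?z)" by simp
    \<comment> \<open>Both products leave indices in place, so \<open>?z k\<close> vanishes wherever
      \<open>y k\<close> does; at the identity \<open>T\<close> is trivial and commutativity of
      \<open>R\<close> makes the terms cancel.\<close>
    have z: "?z k = y k \<otimes>\<^bsub>R\<^esub> T k r \<oplus>\<^bsub>R\<^esub> \<ominus>\<^bsub>R\<^esub> (r \<otimes>\<^bsub>R\<^esub> y k)"
      if "k \<in> carrier G" for k
      using that r yS closed by (simp add: S_add_coeff S_a_inv_coeff mult_one_coeff one_mult_coeff)
    have "?z \<one>\<^bsub>G\<^esub> = \<zero>\<^bsub>R\<^esub>"
      using r yS by (simp add: z T_id comm[of r] S_coeff_closed R.r_neg)
    then have "supp ?z \<subseteq> supp y - {\<one>\<^bsub>G\<^esub>}"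
      using r by (auto simp: supp_def z T_closed)
    then have "supp ?z \<subset> supp y"
      using y1 by (auto simp: supp_def)
    then have "card (supp ?z) < card (supp y)"
      by (rule psubset_card_mono[OF finite_supp[OF yS]])
    with le show False by simp
  qed
  then have "y \<in> centralizer S (base_ring_copy G R)"
    using yS by (simp add: centralizer_def base_ring_copy_eq)
  then obtain r where r: "r \<in> carrier R" "y = monomial r \<one>\<^bsub>G\<^esub>"
    unfolding base by (auto simp: base_ring_copy_eq)
  then show ?thesis
    using that yJ y1 by (auto simp: monomial_coeff)
qed

text \<open>A nonzero ideal \<open>J\<close> meets the base copy nontrivially, so its restriction
  \<open>?I\<close> is a nonzero invariant ideal, hence all of \<open>R\<close>; then
  \<open>J\<close> contains the identity.\<close>

lemma simple_if_action_simple: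
  assumes max: "maximal_commutative (base_ring_copy G R) S"
    and simple: "action_simple G R D \<alpha>"
  shows "simple_ring S"
  unfolding simple_ring_def
proof (intro conjI allI impI)
  show "ring S" by (rule S_ring)
  fix J assume J: "ideal J S"
  interpret J: ideal J S by (rule J)
  let ?I = "{r \<in> carrier R. monomial r \<one>\<^bsub>G\<^esub> \<in> J}"
  show "J = {\<zero>\<^bsub>S\<^esub>} \<or> J = carrier S"
  proof (cases "J = {\<zero>\<^bsub>S\<^esub>}")
    case False
    then obtain r where "r \<in> ?I" "r \<noteq> \<zero>\<^bsub>R\<^esub>"
      using maximal_commutative_ideal_meets_base[OF max J] by blast
    then have "?I = carrier R"
      using simple ideal_restriction_invariant[OF J] by (auto simp: action_simple_def)
    then have "\<one>\<^bsub>S\<^esub> \<in> J"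
      using R.one_closed unfolding S_one by blast
    then show ?thesis
      using J.one_imp_carrier by blast
  qed simp
qed

end

theorem theorem2p13:
  fixes G :: "('g, 'n) monoid_scheme"
    and R :: "('r, 'm) ring_scheme"
    and D :: "'g \<Rightarrow> 'r set"
    and \<alpha> :: "'g \<Rightarrow> 'r \<Rightarrow> 'r"
    and w :: "'g \<Rightarrow> 'g \<Rightarrow> 'r"
    and u :: "'g \<Rightarrow> 'r"
  assumes "unital_twisted_partial_action G R D \<alpha> w u"
    and "maximal_commutative (base_ring_copy G R) (crossed_product G R D \<alpha> w)"
  shows "simple_ring (crossed_product G R D \<alpha> w) \<longleftrightarrow> action_simple G R D \<alpha>"
  using assms
  by (blast intro: unital_twisted_partial_action.action_simple_if_simple
      unital_twisted_partial_action.simple_if_action_simple)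

end
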